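(* Assume the continuum hypothesis. There exist separable compact lines $K$ and $L$, with $L$ Borel regular, and a continuous increasing surjection $\phi:K\to L$ that has the $c_0$-extension property, but is not of countable type.
   Context: A compact line is a linearly ordered set which is compact in its order topology. "Increasing" means order-preserving in the weak sense. "Countable" means finite or countably infinite. For a compact Hausdorff space $K$, $C(K)$ is the Banach space of continuous real-valued functions on $K$ with the supremum norm. A closed subspace $Y$ of a Banach space $X$ has the $c_0$-extension property in $X$ if every bounded operator $Y\to c_0$ admits a bounded extension $X\to c_0$. For a continuous increasing surjection $\phi:K\to L$ between compact lines, let $\phi^*:C(L)\to C(K)$, $\phi^*(f)=f\circ\phi$; $\phi$ is said to have the $c_0$-extension property if the range $\phi^*C(L)$ has the $c_0$-extension property in $C(K)$. A point $x$ of a linearly ordered set $X$ is internal if it is neither the minimum nor the maximum of $X$, for every $y\in X$ with $y>x$ the interval $]x,y[$ is nonempty, and for every $y\in X$ with $y<x$ the interval $]y,x[$ is nonempty. Let $Q(\phi)=\{t\in L: |\phi^{-1}(t)|>1\}$ and $Q_0(\phi)=\{t\in Q(\phi): t \text{ is an internal point of } L\}$. The map $\phi$ is of countable type if $Q_0(\phi)$ is countable. A separable compact line $L$ is Borel regular if its set of internal points is a Borel subset of $L$. *)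

theory Defs
  imports "HOL-Analysis.Analysis" "HOL-Probability.Discrete_Topology"
begin

unbundle cardinal_syntax

definition continuum_hypothesis :: bool where
  "continuum_hypothesis \<longleftrightarrow> |UNIV :: real set| =o cardSuc natLeq"

text \<open>
  A linearly ordered set is a reflexive linear order r; its underlying set is Field r.
  The open rays generate the order topology, exactly as in the library's class order_topology;
  Field r itself is a generator so that it is the whole space also when r has only one point.
\<close>

definition order_top :: "'a rel \<Rightarrow> 'a topology" where
  "order_top r = topology_generated_by
     (insert (Field r) (underS r ` Field r \<union> aboveS r ` Field r))"

definition compact_line :: "'a rel \<Rightarrow> bool" where
  "compact_line r \<longleftrightarrow> Linear_order r \<and> compact_space (order_top r)"

definition internal_point :: "'a rel \<Rightarrow> 'a \<Rightarrow> bool" where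
  "internal_point r x \<longleftrightarrow> x \<in> Field r
     \<and> \<not> (\<forall>y\<in>Field r. (x, y) \<in> r) \<and> \<not> (\<forall>y\<in>Field r. (y, x) \<in> r)
     \<and> (\<forall>y\<in>aboveS r x. aboveS r x \<inter> underS r y \<noteq> {})
     \<and> (\<forall>y\<in>underS r x. aboveS r y \<inter> underS r x \<noteq> {})"

definition borel_sets_of :: "'a topology \<Rightarrow> 'a set set" where
  "borel_sets_of X = sigma_sets (topspace X) {U. openin X U}"

definition Borel_regular :: "'a rel \<Rightarrow> bool" where
  "Borel_regular r \<longleftrightarrow> compact_line r \<and> separable_space (order_top r)
     \<and> {x. internal_point r x} \<in> borel_sets_of (order_top r)"

definition bounded_operator_on ::
  "'a::real_normed_vector set \<Rightarrow> ('a \<Rightarrow> 'b::real_normed_vector) \<Rightarrow> bool" where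
  "bounded_operator_on X T \<longleftrightarrow>
     (\<forall>x\<in>X. \<forall>y\<in>X. T (x + y) = T x + T y) \<and> (\<forall>a. \<forall>x\<in>X. T (a *\<^sub>R x) = a *\<^sub>R T x)
     \<and> (\<exists>B. \<forall>x\<in>X. norm (T x) \<le> B * norm x)"

text \<open>As nat is a discrete space, its bounded continuous real functions form the space of
  bounded real sequences with the supremum norm.\<close>

definition c0 :: "(nat \<Rightarrow>\<^sub>C real) set" where
  "c0 = {s. apply_bcontfun s \<longlonglongrightarrow> 0}"

text \<open>A Banach space is a complete linear subspace X of an ambient normed space.\<close>

definition c0_extension_property_in :: "'a::real_normed_vector set \<Rightarrow> 'a set \<Rightarrow> bool" where
  "c0_extension_property_in Y X \<longleftrightarrow>
     subspace X \<and> complete X \<and> subspace Y \<and> closed Y \<and> Y \<subseteq> X \<and>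
     (\<forall>T :: 'a \<Rightarrow> nat \<Rightarrow>\<^sub>C real. bounded_operator_on Y T \<and> T ` Y \<subseteq> c0 \<longrightarrow>
        (\<exists>S :: 'a \<Rightarrow> nat \<Rightarrow>\<^sub>C real. bounded_operator_on X S \<and> S ` X \<subseteq> c0 \<and> (\<forall>y\<in>Y. S y = T y)))"

text \<open>
  The points of a space X form a subset of a type, so C(X) is realised inside the normed space
  of all bounded real functions on that type (bounded continuous functions on its discrete copy):
  a continuous function on X, which is bounded when X is compact, is extended by 0 off X.
  The ambient norm is then the supremum norm over X.
\<close>

definition C_space :: "'a topology \<Rightarrow> ('a discrete \<Rightarrow>\<^sub>C real) set" where
  "C_space X = {f. continuous_map X euclideanreal (\<lambda>x. apply_bcontfun f (discrete x))
     \<and> (\<forall>x. x \<notin> topspace X \<longrightarrow> apply_bcontfun f (discrete x) = 0)}"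

definition pullback ::
  "'a topology \<Rightarrow> ('a \<Rightarrow> 'b) \<Rightarrow> ('b discrete \<Rightarrow>\<^sub>C real) \<Rightarrow> ('a discrete \<Rightarrow>\<^sub>C real)" where
  "pullback X \<phi> f = Bcontfun (\<lambda>d. if of_discrete d \<in> topspace X
     then apply_bcontfun f (discrete (\<phi> (of_discrete d))) else 0)"

lemma apply_pullback:
  "apply_bcontfun (pullback X \<phi> f) (discrete x) =
     (if x \<in> topspace X then apply_bcontfun f (discrete (\<phi> x)) else 0)"
proof -
  let ?g = "\<lambda>d. if of_discrete d \<in> topspace X
     then apply_bcontfun f (discrete (\<phi> (of_discrete d))) else 0"
  have "range ?g \<subseteq> insert 0 (range (apply_bcontfun f))"
    by auto
  then have "bounded (range ?g)"
    by (meson bounded_apply_bcontfun bounded_insert bounded_subset)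
  moreover have "continuous_on UNIV ?g"
    by (simp add: continuous_on_open_invariant open_discrete)
  ultimately have "?g \<in> bcontfun"
    by (simp add: bcontfun_def)
  then show ?thesis
    by (simp add: pullback_def Bcontfun_inverse discrete_inverse)
qed

definition continuous_increasing_surjection :: "'a rel \<Rightarrow> 'b rel \<Rightarrow> ('a \<Rightarrow> 'b) \<Rightarrow> bool" where
  "continuous_increasing_surjection K L \<phi> \<longleftrightarrow>
     continuous_map (order_top K) (order_top L) \<phi>
     \<and> monotone_on (Field K) (\<lambda>x y. (x, y) \<in> K) (\<lambda>s t. (s, t) \<in> L) \<phi>
     \<and> \<phi> ` Field K = Field L"

definition has_c0_extension_property :: "'a rel \<Rightarrow> 'b rel \<Rightarrow> ('a \<Rightarrow> 'b) \<Rightarrow> bool" where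
  "has_c0_extension_property K L \<phi> \<longleftrightarrow>
     c0_extension_property_in (pullback (order_top K) \<phi> ` C_space (order_top L))
       (C_space (order_top K))"

definition Q_set :: "'a rel \<Rightarrow> 'b rel \<Rightarrow> ('a \<Rightarrow> 'b) \<Rightarrow> 'b set" where
  "Q_set K L \<phi> = {t \<in> Field L. \<exists>x\<in>Field K. \<exists>y\<in>Field K. x \<noteq> y \<and> \<phi> x = t \<and> \<phi> y = t}"

definition Q0_set :: "'a rel \<Rightarrow> 'b rel \<Rightarrow> ('a \<Rightarrow> 'b) \<Rightarrow> 'b set" where
  "Q0_set K L \<phi> = {t \<in> Q_set K L \<phi>. internal_point L t}"

definition countable_type :: "'a rel \<Rightarrow> 'b rel \<Rightarrow> ('a \<Rightarrow> 'b) \<Rightarrow> bool" where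
  "countable_type K L \<phi> \<longleftrightarrow> countable (Q0_set K L \<phi>)"

end

theory Submission
  imports Defs
begin


text \<open>
  Both lines are split intervals: for a set \<open>B\<close> of reals, the split interval over \<open>B\<close> is
  \<open>[0,1]\<close> with every point \<open>x\<close> of \<open>B\<close> replaced by two neighbours \<open>(x,0) < (x,1)\<close>.
  Take a Borel set \<open>P \<subseteq> ]0,1[\<close> and an uncountable \<open>Q \<subseteq> P\<close>, put \<open>A = [0,1] - P\<close>, let \<open>L\<close> be
  split over \<open>A\<close> and \<open>K\<close> over \<open>A \<union> Q\<close>, and let \<open>\<phi>\<close> collapse the pairs over \<open>Q\<close>.  The internal
  points of \<open>L\<close> are its unsplit points \<open>(x,0)\<close> with \<open>x \<in> P\<close>.  So \<open>L\<close> is Borel regular, and \<open>\<phi>\<close> is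
  not of countable type because every point of \<open>Q\<close> contributes a nontrivial fibre.
  
  The range of \<open>\<phi>\<^sup>*\<close> consists of the functions in \<open>C(K)\<close> without jumps at the points of \<open>Q\<close>
  (\<open>range_pullback_collapse\<close>), and together with the indicators \<open>h\<^sub>q\<close> of the initial segments
  ending in \<open>(q,0)\<close> it spans a dense subspace of \<open>C(K)\<close> (\<open>finitely_many_jumps_dense\<close>).  Hence an
  operator \<open>T\<close> from this range to \<open>c\<^sub>0\<close>, with coordinate functionals \<open>\<Lambda>\<^sub>n\<close>, is extended by choosing
  the images of the \<open>h\<^sub>q\<close>.  The natural choice for the \<open>n\<close>-th coordinate is the cut value
  \<open>F\<^sub>n(q)\<close>, the limit of \<open>\<Lambda>\<^sub>n\<close> along continuous ramps that fall from 1 to 0 just to the right of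
  \<open>q\<close>; it exists because \<open>\<Lambda>\<^sub>n\<close> is bounded (\<open>ramp_oscillation\<close>), and it keeps the operator bounded.
  The image of \<open>h\<^sub>q\<close> is then in \<open>c\<^sub>0\<close> unless \<open>q\<close> belongs to the exceptional set
  \<open>R = {q \<in> Q. \<not> F\<^sub>n(q) \<longlonglongrightarrow> 0}\<close>.  If \<open>R\<close> is countable, this can be repaired: for the first
  \<open>\<kappa>(n)\<close> points of an enumeration of \<open>R\<close> one evaluates \<open>\<Lambda>\<^sub>n\<close> at ramps of a fixed positive
  width instead of passing to the limit.  For fixed ramps these values tend to 0 as
  \<open>n\<close> grows, and they still do if \<open>\<kappa>\<close> increases slowly; disjointness of the ramps preserves
  boundedness (\<open>null_cut_corrections\<close>, \<open>extend_c0_operator\<close>).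
  
  It remains to make \<open>R\<close> countable for every \<open>T\<close>.  If \<open>a \<in> A\<close>, the indicator of the initial
  segment ending in \<open>(a,0)\<close> is continuous on \<open>L\<close>, so \<open>\<Lambda>\<^sub>n\<close> tends to 0 on it.  This forces \<open>R\<close>,
  up to countably many points, into a countable union of G-delta sets that avoid \<open>A\<close>
  (\<open>exceptional_cuts\<close>).  So it suffices that \<open>Q\<close> has countable intersection with every G-delta
  subset of \<open>P\<close>.  Under the continuum hypothesis such a \<open>Q\<close> is chosen in the manner of Luzin, by running
  through the G-delta subsets of \<open>P\<close> (\<open>Luzin_type_set\<close>), provided that countably many of them
  never cover \<open>P\<close>.  A Borel set \<open>P\<close> with this property comes from diagonalizing over
  all countable unions of G-delta sets (\<open>Borel_set_not_covered\<close>).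
\<close>

section \<open>Split intervals as compact lines\<close>

definition split_points :: "real set \<Rightarrow> (real \<times> real) set" where
  "split_points B = {p. 0 \<le> fst p \<and> fst p \<le> 1 \<and> (snd p = 0 \<or> snd p = 1 \<and> fst p \<in> B)}"

definition split_line :: "real set \<Rightarrow> (real \<times> real) rel" where
  "split_line B = {(p, q). p \<in> split_points B \<and> q \<in> split_points B \<and>
     (fst p < fst q \<or> fst p = fst q \<and> snd p \<le> snd q)}"

text \<open>
  The basic order neighbourhoods in terms of real distances: to the left of \<open>p\<close> unless \<open>p\<close> is the
  upper twin, to the right of \<open>p\<close> unless \<open>p\<close> is the lower twin of a split point.
\<close>

definition split_nbhd :: "real set \<Rightarrow> real \<times> real \<Rightarrow> real \<Rightarrow> (real \<times> real) set" where
  "split_nbhd B p \<delta> = {q \<in> split_points B. q = p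
     \<or> snd p = 0 \<and> fst p - \<delta> < fst q \<and> fst q < fst p
     \<or> (snd p = 1 \<or> fst p \<notin> B) \<and> fst p < fst q \<and> fst q < fst p + \<delta>}"

lemma split_nbhd_subset: "split_nbhd B p \<delta> \<subseteq> split_points B"
  by (auto simp: split_nbhd_def)

lemma split_nbhd_mono: "\<delta> \<le> \<delta>' \<Longrightarrow> split_nbhd B p \<delta> \<subseteq> split_nbhd B p \<delta>'"
  by (auto simp: split_nbhd_def)

lemma Field_split_line [simp]: "Field (split_line B) = split_points B"
proof
  show "split_points B \<subseteq> Field (split_line B)"
    by (rule subsetI, rule FieldI1[of _ _ "split_line B"]) (auto simp: split_line_def)
qed (auto simp: Field_def split_line_def)

lemma Linear_order_split_line: "Linear_order (split_line B)"
  unfolding linear_order_on_def partial_order_on_def preorder_on_def Field_split_line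
  by (auto simp: refl_on_def trans_def antisym_def total_on_def split_line_def prod_eq_iff)

text \<open>
  This description of the topology replaces the order by the real coordinate, so that continuity on
  a split line becomes an \<open>\<epsilon>\<close>-\<open>\<delta>\<close> condition, and compactness reduces to that of \<open>[0,1]\<close>.
\<close>

lemma openin_split_line:
  "openin (order_top (split_line B)) U \<longleftrightarrow>
     U \<subseteq> split_points B \<and> (\<forall>p\<in>U. \<exists>\<delta>>0. split_nbhd B p \<delta> \<subseteq> U)"
    (is "_ \<longleftrightarrow> ?P U")
proof
  assume "openin (order_top (split_line B)) U"
  then have "generate_topology_on (insert (split_points B)
      (underS (split_line B) ` split_points B \<union> aboveS (split_line B) ` split_points B)) U"
    by (simp add: order_top_def openin_topology_generated_by_iff)
  then show "?P U"
  proof induction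
    case Empty
    then show ?case by simp
  next
    case (Int V W)
    show ?case
    proof (intro conjI ballI)
      show "V \<inter> W \<subseteq> split_points B" using Int.IH by blast
      fix p assume p: "p \<in> V \<inter> W"
      then obtain d e where "d > 0" "split_nbhd B p d \<subseteq> V" "e > 0" "split_nbhd B p e \<subseteq> W"
        using Int.IH by blast
      then have "min d e > 0 \<and> split_nbhd B p (min d e) \<subseteq> V \<inter> W"
        using split_nbhd_mono[of "min d e" d B p] split_nbhd_mono[of "min d e" e B p] by auto
      then show "\<exists>\<delta>>0. split_nbhd B p \<delta> \<subseteq> V \<inter> W" by blast
    qed
  next
    case (UN \<K>)
    then show ?case by (meson Sup_upper UnionE Sup_least order_trans)
  next
    case (Basis V)
    consider "V = split_points B"
      | z where "z \<in> split_points B" "V = underS (split_line B) z"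
      | z where "z \<in> split_points B" "V = aboveS (split_line B) z"
      using Basis by blast
    then show ?case
    proof cases
      case 1
      then show ?thesis using split_nbhd_subset zero_less_one by blast
    next
      case (2 z)
      have "\<exists>\<delta>>0. split_nbhd B p \<delta> \<subseteq> V" if "p \<in> V" for p
        using 2 that
        by (intro exI[of _ "if fst p < fst z then fst z - fst p else 1"])
          (auto simp: underS_def split_line_def split_nbhd_def split_points_def prod_eq_iff)
      then show ?thesis using 2 by (auto simp: underS_def split_line_def)
    next
      case (3 z)
      have "\<exists>\<delta>>0. split_nbhd B p \<delta> \<subseteq> V" if "p \<in> V" for p
      proof (intro exI conjI subsetI)
        let ?d = "if fst z < fst p then fst p - fst z else 1"
        show "?d > 0" by simp
        fix q assume q: "q \<in> split_nbhd B p ?d"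
        then have "q \<in> split_points B" by (simp add: split_nbhd_def)
        have "fst z < fst p \<or> fst z = fst p \<and> snd z = 0 \<and> snd p = 1"
          using that 3 by (auto simp: aboveS_def split_line_def split_points_def prod_eq_iff)
        then have "fst z < fst q \<or> fst z = fst q \<and> snd z = 0 \<and> snd q = 1"
          using q by (auto simp: split_nbhd_def split: if_splits)
        then show "q \<in> V" using 3 \<open>q \<in> split_points B\<close>
          by (auto simp: aboveS_def split_line_def)
      qed
      then show ?thesis using 3 by (auto simp: aboveS_def split_line_def)
    qed
  qed
next
  assume U: "?P U"
  let ?T = "order_top (split_line B)"
  have whole: "openin ?T (split_points B)"
    unfolding order_top_def by (rule topology_generated_by_Basis) simp
  have under: "openin ?T (underS (split_line B) z)" if "z \<in> split_points B" for z
    unfolding order_top_def using that by (intro topology_generated_by_Basis) simp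
  have above: "openin ?T (aboveS (split_line B) z)" if "z \<in> split_points B" for z
    unfolding order_top_def using that by (intro topology_generated_by_Basis) simp
  have "\<exists>V. openin ?T V \<and> p \<in> V \<and> V \<subseteq> U" if "p \<in> U" for p
  proof -
    from U have "\<exists>\<delta>>0. split_nbhd B p \<delta> \<subseteq> U" using that by (rule bspec[OF conjunct2])
    then obtain d where d: "d > 0" "split_nbhd B p d \<subseteq> U" by (elim exE conjE)
    have p: "p \<in> split_points B" using U that by (elim conjE) (rule subsetD)
    have "\<exists>V. openin ?T V \<and> p \<in> V \<and> (\<forall>q\<in>V. q \<in> split_points B \<and>
        (fst p < fst q \<or> q = p \<or> snd p = 0 \<and> fst p - d < fst q))"
    proof (cases "fst p = 0 \<and> snd p = 0")
      case True
      show ?thesis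
      proof (intro exI conjI ballI)
        fix q assume q: "q \<in> split_points B"
        then have "0 \<le> fst q" by (simp add: split_points_def)
        with True d show "fst p < fst q \<or> q = p \<or> snd p = 0 \<and> fst p - d < fst q"
          by linarith
      qed (use whole p in auto)
    next
      case False
      \<comment> \<open>The upper ray of z cuts V out. If p is an upper twin, z is its lower twin;
      otherwise z lies strictly to the left of p, but not below 0.\<close>
      define z where "z = (if snd p = 0 then (max 0 (fst p - d/2), 0) else (fst p, 0::real))"
      have z: "z \<in> split_points B" using p d by (auto simp: z_def split_points_def)
      have "(z, p) \<in> split_line B \<and> p \<noteq> z"
        using p z d False by (auto simp: z_def split_line_def split_points_def prod_eq_iff)
      moreover have "fst p < fst q \<or> q = p \<or> snd p = 0 \<and> fst p - d < fst q"
        if q: "(z, q) \<in> split_line B" "q \<noteq> z" for q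
      proof (cases "snd p = 0")
        case True
        then have "max 0 (fst p - d/2) \<le> fst q"
          using q by (auto simp: z_def split_line_def)
        then show ?thesis using True d by linarith
      next
        case False
        then show ?thesis using q p
          by (auto simp: z_def split_line_def split_points_def prod_eq_iff)
      qed
      ultimately show ?thesis using above[OF z]
        by (intro exI[of _ "aboveS (split_line B) z"]) (auto simp: aboveS_def split_line_def)
    qed
    then obtain V where V: "openin ?T V" "p \<in> V" "\<And>q. q \<in> V \<Longrightarrow> q \<in> split_points B \<and>
        (fst p < fst q \<or> q = p \<or> snd p = 0 \<and> fst p - d < fst q)" by blast
    have "\<exists>W. openin ?T W \<and> p \<in> W \<and> (\<forall>q\<in>W. q \<in> split_points B \<and>
        (fst q < fst p \<or> q = p \<or> (snd p = 1 \<or> fst p \<notin> B) \<and> fst q < fst p + d))"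
    proof (cases "fst p = 1 \<and> (snd p = 1 \<or> fst p \<notin> B)")
      case True
      show ?thesis
      proof (intro exI conjI ballI)
        fix q assume q: "q \<in> split_points B"
        then have "fst q \<le> 1" by (simp add: split_points_def)
        with True d show "fst q < fst p \<or> q = p \<or> (snd p = 1 \<or> fst p \<notin> B) \<and> fst q < fst p + d"
          by linarith
      qed (use whole p in auto)
    next
      case False
      \<comment> \<open>Symmetrically z bounds W from above; if p is the lower twin of a split point, z is its upper twin.\<close>
      define z where "z = (if snd p = 1 \<or> fst p \<notin> B then (min 1 (fst p + d/2), 0) else (fst p, 1::real))"
      have z: "z \<in> split_points B" using p d by (auto simp: z_def split_points_def)
      have "fst p < fst z \<or> fst p = fst z \<and> snd p < snd z"
        using p d False by (cases "fst p = 1") (auto simp: z_def split_points_def)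
      then have "(p, z) \<in> split_line B \<and> p \<noteq> z"
        using p z by (auto simp: split_line_def)
      moreover have "fst q < fst p \<or> q = p \<or> (snd p = 1 \<or> fst p \<notin> B) \<and> fst q < fst p + d"
        if q: "(q, z) \<in> split_line B" "q \<noteq> z" for q
      proof (cases "snd p = 1 \<or> fst p \<notin> B")
        case True
        then have "fst q \<le> min 1 (fst p + d/2)"
          using q by (auto simp: z_def split_line_def)
        then show ?thesis using True d by linarith
      next
        case False
        then show ?thesis using q p
          by (auto simp: z_def split_line_def split_points_def prod_eq_iff)
      qed
      ultimately show ?thesis using under[OF z]
        by (intro exI[of _ "underS (split_line B) z"]) (auto simp: underS_def split_line_def)
    qed
    then obtain W where W: "openin ?T W" "p \<in> W" "\<And>q. q \<in> W \<Longrightarrow> q \<in> split_points B \<and>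
        (fst q < fst p \<or> q = p \<or> (snd p = 1 \<or> fst p \<notin> B) \<and> fst q < fst p + d)" by blast
    have "V \<inter> W \<subseteq> split_nbhd B p d"
    proof
      fix q assume "q \<in> V \<inter> W"
      with V(3)[of q] W(3)[of q] p show "q \<in> split_nbhd B p d"
        by (cases "fst q = fst p") (auto simp: split_nbhd_def split_points_def prod_eq_iff)
    qed
    then show ?thesis
      using V(1,2) W(1,2) d by (intro exI[of _ "V \<inter> W"]) (auto simp: openin_Int)
  qed
  then show "openin ?T U" by (subst openin_subopen) blast
qed

lemma topspace_split_line [simp]: "topspace (order_top (split_line B)) = split_points B"
proof -
  have "openin (order_top (split_line B)) (split_points B)"
    unfolding openin_split_line using split_nbhd_subset zero_less_one by blast
  moreover have "topspace (order_top (split_line B)) \<subseteq> split_points B"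
    using openin_split_line openin_topspace by blast
  ultimately show ?thesis by (simp add: openin_subset subset_antisym)
qed

text \<open>
  The fibre over \<open>x\<close> has at most two points, so neighbourhoods of these contain all points
  over an interval around \<open>x\<close>.  This lets covering arguments on a split line run over
  \<open>[0,1]\<close>.
\<close>

lemma split_nbhd_around:
  assumes "0 \<le> x" "x \<le> 1"
    and "\<And>e. (x, e) \<in> split_points B \<Longrightarrow> \<exists>\<delta>>0. split_nbhd B (x, e) \<delta> \<subseteq> U e"
  shows "\<exists>\<delta>>0. \<forall>p\<in>split_points B. \<bar>fst p - x\<bar> < \<delta> \<longrightarrow>
           (if fst p < x \<or> x \<notin> B \<or> p = (x, 0) then p \<in> U 0 else p \<in> U 1)"
proof -
  have "(x, 0) \<in> split_points B" using assms by (simp add: split_points_def)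
  then obtain d where d: "d > 0" "split_nbhd B (x, 0) d \<subseteq> U 0" using assms(3) by blast
  have "\<exists>e>0. x \<in> B \<longrightarrow> split_nbhd B (x, 1) e \<subseteq> U 1"
  proof (cases "x \<in> B")
    case True
    then show ?thesis using assms by (auto simp: split_points_def)
  qed (auto intro: zero_less_one)
  then obtain e where e: "e > 0" "x \<in> B \<Longrightarrow> split_nbhd B (x, 1) e \<subseteq> U 1" by blast
  have "if fst p < x \<or> x \<notin> B \<or> p = (x, 0) then p \<in> U 0 else p \<in> U 1"
    if p: "p \<in> split_points B" "\<bar>fst p - x\<bar> < min d e" for p
  proof (cases "fst p < x \<or> x \<notin> B \<or> p = (x, 0)")
    case True
    with p have "p \<in> split_nbhd B (x, 0) d"
      by (cases "fst p = x") (auto simp: split_nbhd_def split_points_def prod_eq_iff abs_less_iff)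
    with d True show ?thesis by auto
  next
    case False
    then have "x \<in> B" "fst p > x \<or> p = (x, 1)"
      using p by (auto simp: split_points_def prod_eq_iff)
    with p have "p \<in> split_nbhd B (x, 1) e"
      by (auto simp: split_nbhd_def abs_less_iff)
    with e False show ?thesis by auto
  qed
  with d e show ?thesis by (intro exI[of _ "min d e"]) auto
qed

lemma compact_line_split_line: "compact_line (split_line B)"
proof -
  let ?T = "order_top (split_line B)"
  have "\<exists>\<F>. finite \<F> \<and> \<F> \<subseteq> \<U> \<and> split_points B \<subseteq> \<Union>\<F>"
    if \<U>: "\<forall>U\<in>\<U>. openin ?T U" "split_points B \<subseteq> \<Union>\<U>" for \<U>
  proof -
    have "\<exists>\<F> \<delta>. finite \<F> \<and> \<F> \<subseteq> \<U> \<and> \<delta> > 0 \<and>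
        (\<forall>p\<in>split_points B. \<bar>fst p - x\<bar> < \<delta> \<longrightarrow> p \<in> \<Union>\<F>)" if x: "x \<in> {0..1}" for x
    proof -
      have "\<exists>U. (x, e) \<in> split_points B \<longrightarrow> U \<in> \<U> \<and> (\<exists>\<delta>>0. split_nbhd B (x, e) \<delta> \<subseteq> U)" for e
        using \<U> unfolding openin_split_line by (meson UnionE subsetD)
      then obtain U where U: "\<And>e. (x, e) \<in> split_points B \<Longrightarrow>
          U e \<in> \<U> \<and> (\<exists>\<delta>>0. split_nbhd B (x, e) \<delta> \<subseteq> U e)" by metis
      then obtain d where d: "d > 0" "\<forall>p\<in>split_points B. \<bar>fst p - x\<bar> < d \<longrightarrow>
           (if fst p < x \<or> x \<notin> B \<or> p = (x, 0) then p \<in> U 0 else p \<in> U 1)"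
        using split_nbhd_around[of x B U] x by auto
      have "U 0 \<in> \<U>" "x \<in> B \<Longrightarrow> U 1 \<in> \<U>" using x U by (auto simp: split_points_def)
      then show ?thesis using d
        by (intro exI[of _ "U ` (if x \<in> B then {0,1} else {0})"] exI[of _ d]) (auto split: if_splits)
    qed
    then obtain F D where FD: "\<And>x. x \<in> {0..1} \<Longrightarrow> finite (F x) \<and> F x \<subseteq> \<U> \<and> D x > 0 \<and>
        (\<forall>p\<in>split_points B. \<bar>fst p - x\<bar> < D x \<longrightarrow> p \<in> \<Union>(F x))" by metis
    have "{0..1::real} \<subseteq> (\<Union>x\<in>{0..1}. ball x (D x))" using FD by force
    then obtain X where X: "X \<subseteq> {0..1}" "finite X" "{0..1} \<subseteq> (\<Union>x\<in>X. ball x (D x))"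
      using compactE_image[OF compact_Icc, of "{0..1}" "\<lambda>x. ball x (D x)" 0 1]
      by (metis open_ball)
    have "split_points B \<subseteq> \<Union>(\<Union>x\<in>X. F x)"
    proof
      fix p assume p: "p \<in> split_points B"
      then have "fst p \<in> {0..1}" by (simp add: split_points_def)
      then obtain x where "x \<in> X" "\<bar>fst p - x\<bar> < D x"
        using X(3) by (auto simp: dist_real_def abs_minus_commute)
      moreover have "x \<in> {0..1}" using \<open>x \<in> X\<close> X(1) by (rule subsetD[rotated])
      ultimately have "p \<in> \<Union>(F x)" using p FD[of x] by simp
      with \<open>x \<in> X\<close> show "p \<in> \<Union>(\<Union>x\<in>X. F x)" by auto
    qed
    moreover have "finite (\<Union>x\<in>X. F x)" "(\<Union>x\<in>X. F x) \<subseteq> \<U>"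
      using FD X(1,2) by (auto simp: subset_iff)
    ultimately show ?thesis by (intro exI[of _ "\<Union>x\<in>X. F x"] conjI)
  qed
  then have "compact_space ?T"
    by (simp add: compact_space_alt)
  then show ?thesis using Linear_order_split_line by (simp only: compact_line_def)
qed

lemma separable_split_line: "separable_space (order_top (split_line B))"
proof -
  let ?D = "split_points B \<inter> (\<rat> \<times> {0, 1})"
  have "countable ?D"
    by (intro countable_Int2 countable_SIGMA countable_rat) auto
  moreover have "p \<in> order_top (split_line B) closure_of ?D" if p: "p \<in> split_points B" for p
    unfolding in_closure_of topspace_split_line
  proof (intro conjI allI impI p)
    fix U assume "p \<in> U \<and> openin (order_top (split_line B)) U"
    then obtain d where d: "d > 0" "split_nbhd B p d \<subseteq> U" and pU: "p \<in> U"
      unfolding openin_split_line by blast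
    show "\<exists>y. y \<in> ?D \<and> y \<in> U"
    proof (cases "fst p \<in> \<rat>")
      case True
      then show ?thesis using p pU by (intro exI[of _ p]) (auto simp: split_points_def mem_Times_iff)
    next
      case False
      then have "fst p \<noteq> 0" "fst p \<noteq> 1" by auto
      then have x: "0 < fst p" "fst p < 1" using p by (auto simp: split_points_def)
      obtain q where q: "q \<in> \<rat>" "if snd p = 0 then max 0 (fst p - d) < q \<and> q < fst p
          else fst p < q \<and> q < min 1 (fst p + d)"
        using Rats_dense_in_real[of "max 0 (fst p - d)" "fst p"]
          Rats_dense_in_real[of "fst p" "min 1 (fst p + d)"] x d by (cases "snd p = 0") auto
      have "(q, 0) \<in> split_nbhd B p d"
        using q p x by (auto simp: split_nbhd_def split_points_def split: if_splits)
      then show ?thesis using q d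
        by (intro exI[of _ "(q, 0)"]) (auto simp: split_nbhd_def[of _ _ 0] dest: subsetD[OF split_nbhd_subset])
    qed
  qed
  ultimately show ?thesis
    unfolding separable_space_def
    by (metis Int_lower1 closure_of_subset_topspace subsetI subset_antisym topspace_split_line)
qed

lemma continuous_map_split_line_iff:
  "continuous_map (order_top (split_line B)) euclideanreal g \<longleftrightarrow>
     (\<forall>p\<in>split_points B. \<forall>\<epsilon>>0. \<exists>\<delta>>0. \<forall>q\<in>split_nbhd B p \<delta>. \<bar>g q - g p\<bar> < \<epsilon>)"
    (is "_ \<longleftrightarrow> ?R")
proof
  assume L: "continuous_map (order_top (split_line B)) euclideanreal g"
  show ?R
  proof (intro ballI allI impI)
    fix p and \<epsilon> :: real assume p: "p \<in> split_points B" and "\<epsilon> > 0"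
    have "openin (order_top (split_line B)) {q \<in> split_points B. g q \<in> ball (g p) \<epsilon>}"
      using openin_continuous_map_preimage[OF L, of "ball (g p) \<epsilon>"] by simp
    then obtain d where "d > 0" "split_nbhd B p d \<subseteq> {q \<in> split_points B. g q \<in> ball (g p) \<epsilon>}"
      using p \<open>\<epsilon> > 0\<close> unfolding openin_split_line by (metis (mono_tags, lifting) centre_in_ball mem_Collect_eq)
    then show "\<exists>\<delta>>0. \<forall>q\<in>split_nbhd B p \<delta>. \<bar>g q - g p\<bar> < \<epsilon>"
      by (intro exI[of _ d]) (auto simp: dist_real_def abs_minus_commute)
  qed
next
  assume R: ?R
  show "continuous_map (order_top (split_line B)) euclideanreal g"
    unfolding continuous_map_def
  proof (intro conjI allI impI)
    fix U :: "real set" assume "openin euclideanreal U"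
    then have U: "open U" by simp
    show "openin (order_top (split_line B)) {x \<in> topspace (order_top (split_line B)). g x \<in> U}"
      unfolding openin_split_line
    proof (intro conjI ballI)
      fix p assume p: "p \<in> {x \<in> topspace (order_top (split_line B)). g x \<in> U}"
      then obtain e where e: "e > 0" "\<And>y. \<bar>y - g p\<bar> < e \<Longrightarrow> y \<in> U"
        using U by (auto simp: open_dist dist_real_def)
      from p have "p \<in> split_points B" by simp
      with R e(1) obtain d where "d > 0" "\<forall>q\<in>split_nbhd B p d. \<bar>g q - g p\<bar> < e" by meson
      with e show "\<exists>\<delta>>0. split_nbhd B p \<delta> \<subseteq> {x \<in> topspace (order_top (split_line B)). g x \<in> U}"
        by (intro exI[of _ d]) (auto simp: split_nbhd_def)
    qed auto
  qed auto
qed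



section \<open>Continuous functions on split lines\<close>

abbreviation val :: "('a discrete \<Rightarrow>\<^sub>C real) \<Rightarrow> 'a \<Rightarrow> real" where
  "val f p \<equiv> apply_bcontfun f (discrete p)"

definition from_fun :: "('a \<Rightarrow> real) \<Rightarrow> ('a discrete \<Rightarrow>\<^sub>C real)" where
  "from_fun g = Bcontfun (\<lambda>d. g (of_discrete d))"

lemma val_from_fun:
  assumes "\<And>p. \<bar>g p\<bar> \<le> b"
  shows "val (from_fun g) p = g p"
proof -
  have "bounded (range (\<lambda>d. g (of_discrete d)))"
    using assms by (auto simp: bounded_iff)
  moreover have "continuous_on UNIV (\<lambda>d. g (of_discrete d))"
    by (simp add: continuous_on_open_invariant open_discrete)
  ultimately show ?thesis
    by (simp add: from_fun_def bcontfun_def Bcontfun_inverse discrete_inverse)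
qed

lemma val_add [simp]: "val (f + g) p = val f p + val g p"
  by (simp add: plus_bcontfun.rep_eq)

lemma val_diff [simp]: "val (f - g) p = val f p - val g p"
  by (simp add: minus_bcontfun.rep_eq)

lemma val_scaleR [simp]: "val (c *\<^sub>R f) p = c * val f p"
  by (simp add: scaleR_bcontfun.rep_eq)

lemma val_zero [simp]: "val 0 p = 0"
  by (simp add: zero_bcontfun.rep_eq)

lemma val_sum [simp]: "val (sum f I) p = (\<Sum>i\<in>I. val (f i) p)"
  by (induction I rule: infinite_finite_induct) auto

lemma abs_val_le_norm: "\<bar>val f p\<bar> \<le> norm f"
  using norm_bounded[of f "discrete p"] by simp

lemma norm_le_valI: "(\<And>p. \<bar>val f p\<bar> \<le> b) \<Longrightarrow> norm f \<le> b"
  by (rule norm_bound) (metis of_discrete_inverse real_norm_def)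

lemma val_eqI: "(\<And>p. val f p = val g p) \<Longrightarrow> f = g"
  by (rule bcontfun_eqI) (metis of_discrete_inverse)

definition split_C :: "real set \<Rightarrow> ((real \<times> real) discrete \<Rightarrow>\<^sub>C real) set" where
  "split_C B = C_space (order_top (split_line B))"

lemma split_C_iff:
  "f \<in> split_C B \<longleftrightarrow>
     (\<forall>p\<in>split_points B. \<forall>\<epsilon>>0. \<exists>\<delta>>0. \<forall>q\<in>split_nbhd B p \<delta>. \<bar>val f q - val f p\<bar> < \<epsilon>) \<and>
     (\<forall>p. p \<notin> split_points B \<longrightarrow> val f p = 0)"
  by (simp add: split_C_def C_space_def continuous_map_split_line_iff)

definition jump_free :: "real set \<Rightarrow> real set \<Rightarrow> ((real \<times> real) discrete \<Rightarrow>\<^sub>C real) set" where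
  "jump_free B Q = {f \<in> split_C B. \<forall>q\<in>Q. val f (q, 1) = val f (q, 0)}"

lemma subspace_split_C: "subspace (split_C B)"
  unfolding subspace_def split_C_def C_space_def
  by (auto intro: continuous_map_add continuous_map_real_mult_left)

lemma closed_split_C: "closed (split_C B)"
proof -
  have "f \<in> split_C B" if f: "\<forall>e>0. \<exists>g\<in>split_C B. dist g f < e" for f
  proof -
    have approx: "\<exists>g\<in>split_C B. \<forall>p. \<bar>val f p - val g p\<bar> < e" if "e > 0" for e
    proof -
      obtain g where g: "g \<in> split_C B" "dist g f < e" using f \<open>e > 0\<close> by blast
      have "\<bar>val f p - val g p\<bar> < e" for p
        using abs_val_le_norm[of "f - g" p] g(2) by (simp add: dist_norm norm_minus_commute)
      with g show ?thesis by blast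
    qed
    show ?thesis
      unfolding split_C_iff
    proof (intro conjI ballI allI impI)
      fix p and e :: real assume p: "p \<in> split_points B" and e: "e > 0"
      obtain g where g: "g \<in> split_C B" "\<And>p. \<bar>val f p - val g p\<bar> < e/3"
        using approx[of "e/3"] e by auto
      obtain d where "d > 0" and d: "\<And>q. q \<in> split_nbhd B p d \<Longrightarrow> \<bar>val g q - val g p\<bar> < e/3"
        using g(1) p e unfolding split_C_iff by (meson divide_pos_pos zero_less_numeral)
      have "\<bar>val f q - val f p\<bar> < e" if "q \<in> split_nbhd B p d" for q
        using d[OF that] g(2)[of p] g(2)[of q] by linarith
      with \<open>d > 0\<close> show "\<exists>\<delta>>0. \<forall>q\<in>split_nbhd B p \<delta>. \<bar>val f q - val f p\<bar> < e" by blast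
    next
      fix p assume "p \<notin> split_points B"
      then have "\<bar>val f p\<bar> < e" if "e > 0" for e
        using approx[OF that] by (metis split_C_iff diff_zero)
      then show "val f p = 0" by (metis abs_of_pos less_irrefl zero_less_abs_iff)
    qed
  qed
  then show ?thesis
    by (metis (no_types, lifting) closed_approachable closure_approachable closure_subset_eq subsetI)
qed

lemma subspace_jump_free: "subspace (jump_free B Q)"
  using subspace_split_C[of B] unfolding subspace_def jump_free_def by auto

lemma closed_jump_free: "closed (jump_free B Q)"
proof -
  have "continuous_on UNIV (\<lambda>f::(real \<times> real) discrete \<Rightarrow>\<^sub>C real. val f p)" for p
    unfolding continuous_on_iff by (metis dist_bounded le_less_trans)
  then have "closed {f :: (real \<times> real) discrete \<Rightarrow>\<^sub>C real. val f (q, 1) = val f (q, 0)}" for q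
    by (intro closed_Collect_eq) auto
  then have "closed (split_C B \<inter> (\<Inter>q\<in>Q. {f. val f (q, 1) = val f (q, 0)}))"
    using closed_split_C by (intro closed_Int closed_INT) auto
  also have "split_C B \<inter> (\<Inter>q\<in>Q. {f. val f (q, 1) = val f (q, 0)}) = jump_free B Q"
    by (auto simp: jump_free_def)
  finally show ?thesis .
qed

definition collapse :: "real set \<Rightarrow> real \<times> real \<Rightarrow> real \<times> real" where
  "collapse Q p = (if fst p \<in> Q then (fst p, 0) else p)"

lemma collapse_image: "A \<inter> Q = {} \<Longrightarrow> collapse Q ` split_points (A \<union> Q) = split_points A"
proof (intro equalityI subsetI)
  fix p assume "A \<inter> Q = {}" "p \<in> split_points A"
  then have "p \<in> split_points (A \<union> Q)" "collapse Q p = p"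
    by (auto simp: split_points_def collapse_def prod_eq_iff)
  then show "p \<in> collapse Q ` split_points (A \<union> Q)" by (metis imageI)
qed (auto simp: split_points_def collapse_def)

text \<open>
  The collapse preserves the real coordinate and only merges twins over \<open>Q\<close>, so the same radius
  works in both lines; its continuity follows.
\<close>

lemma collapse_split_nbhd:
  assumes "A \<inter> Q = {}" "p \<in> split_points (A \<union> Q)" "q \<in> split_nbhd (A \<union> Q) p \<delta>"
  shows "collapse Q q \<in> split_nbhd A (collapse Q p) \<delta>"
proof -
  have q: "q \<in> split_points (A \<union> Q)" using assms(3) by (simp add: split_nbhd_def)
  then have "collapse Q q \<in> split_points A" using assms(1) collapse_image by blast
  then show ?thesis
    using assms q by (auto simp: collapse_def split_nbhd_def split_points_def prod_eq_iff)
qed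

lemma continuous_increasing_surjection_collapse:
  assumes "A \<inter> Q = {}"
  shows "continuous_increasing_surjection (split_line (A \<union> Q)) (split_line A) (collapse Q)"
  unfolding continuous_increasing_surjection_def
proof (intro conjI)
  let ?K = "order_top (split_line (A \<union> Q))" and ?L = "order_top (split_line A)"
  have "openin ?K {p \<in> topspace ?K. collapse Q p \<in> U}" if "openin ?L U" for U
    unfolding openin_split_line
  proof (intro conjI ballI)
    fix p assume p: "p \<in> {p \<in> topspace ?K. collapse Q p \<in> U}"
    with \<open>openin ?L U\<close> obtain d where d: "d > 0" "split_nbhd A (collapse Q p) d \<subseteq> U"
      unfolding openin_split_line by blast
    have "split_nbhd (A \<union> Q) p d \<subseteq> {p \<in> topspace ?K. collapse Q p \<in> U}"
    proof
      fix q assume q: "q \<in> split_nbhd (A \<union> Q) p d"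
      then have "collapse Q q \<in> U" using collapse_split_nbhd[OF assms _ q] p d(2) by auto
      with q show "q \<in> {p \<in> topspace ?K. collapse Q p \<in> U}" by (simp add: split_nbhd_def)
    qed
    with d(1) show "\<exists>\<delta>>0. split_nbhd (A \<union> Q) p \<delta> \<subseteq> {p \<in> topspace ?K. collapse Q p \<in> U}"
      by blast
  qed auto
  then show "continuous_map ?K ?L (collapse Q)"
    using collapse_image[OF assms] unfolding continuous_map_def by auto
  show "monotone_on (Field (split_line (A \<union> Q))) (\<lambda>x y. (x, y) \<in> split_line (A \<union> Q))
     (\<lambda>s t. (s, t) \<in> split_line A) (collapse Q)"
    unfolding monotone_on_def Field_split_line
  proof (intro ballI impI)
    fix p q assume "p \<in> split_points (A \<union> Q)" "q \<in> split_points (A \<union> Q)" "(p, q) \<in> split_line (A \<union> Q)"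
    moreover from this have "collapse Q p \<in> split_points A" "collapse Q q \<in> split_points A"
      using collapse_image[OF assms] by blast+
    ultimately show "(collapse Q p, collapse Q q) \<in> split_line A"
      by (auto simp: split_line_def collapse_def)
  qed
qed (simp add: collapse_image[OF assms])

text \<open>
  The image of \<open>C(L)\<close> is characterized inside \<open>C(K)\<close> alone, so that all further arguments take
  place on \<open>K\<close>.  For the harder inclusion, a function without jump at \<open>q\<close> descends to \<open>L\<close>: its
  left continuity at \<open>(q,0)\<close> and its right continuity at \<open>(q,1)\<close> combine to continuity at the
  collapsed point.
\<close>

lemma range_pullback_collapse:
  assumes "A \<inter> Q = {}"
  shows "pullback (order_top (split_line (A \<union> Q))) (collapse Q) ` C_space (order_top (split_line A))
         = jump_free (A \<union> Q) Q"
    (is "?p ` _ = _")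
proof (intro equalityI subsetI)
  let ?K = "order_top (split_line (A \<union> Q))" and ?L = "order_top (split_line A)"
  fix g assume "g \<in> ?p ` C_space ?L"
  then obtain f where f: "f \<in> C_space ?L" "g = ?p f" by blast
  have "continuous_map ?K euclideanreal (val f \<circ> collapse Q)"
    using f(1) continuous_increasing_surjection_collapse[OF assms]
    by (intro continuous_map_compose) (auto simp: C_space_def continuous_increasing_surjection_def)
  then have "continuous_map ?K euclideanreal (val g)"
    by (rule continuous_map_eq) (simp add: f apply_pullback)
  then show "g \<in> jump_free (A \<union> Q) Q"
    by (auto simp: jump_free_def split_C_def C_space_def f apply_pullback split_points_def collapse_def)
next
  fix g assume g: "g \<in> jump_free (A \<union> Q) Q"
  define f where "f = from_fun (\<lambda>p. if p \<in> split_points A then val g p else 0)"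
  have f: "val f p = (if p \<in> split_points A then val g p else 0)" for p
    unfolding f_def by (rule val_from_fun[of _ "norm g"]) (auto simp: abs_val_le_norm)
  have gc: "val g (collapse Q p) = val g p" if "p \<in> split_points (A \<union> Q)" for p
    using g that by (cases p) (auto simp: jump_free_def collapse_def split_points_def)
  have "f \<in> split_C A"
    unfolding split_C_iff
  proof (intro conjI ballI allI impI)
    fix p and e :: real assume p: "p \<in> split_points A" and e: "e > 0"
    have ex: "\<exists>d>0. \<forall>q\<in>split_nbhd (A \<union> Q) r d. \<bar>val g q - val g r\<bar> < e"
      if "r \<in> split_points (A \<union> Q)" for r
      using g that e unfolding jump_free_def split_C_iff by blast
    have p': "p \<in> split_points (A \<union> Q)" using p by (auto simp: split_points_def)
    obtain d where d: "d > 0" "\<And>q. q \<in> split_nbhd (A \<union> Q) p d \<Longrightarrow> \<bar>val g q - val g p\<bar> < e"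
      using ex[OF p'] by blast
    have "\<exists>d'>0. fst p \<in> Q \<longrightarrow> (\<forall>q\<in>split_nbhd (A \<union> Q) (fst p, 1) d'. \<bar>val g q - val g p\<bar> < e)"
    proof (cases "fst p \<in> Q")
      case True
      then have "(fst p, 1) \<in> split_points (A \<union> Q)" "p = (fst p, 0)"
        using p assms by (auto simp: split_points_def prod_eq_iff)
      moreover have "val g (fst p, 1) = val g (fst p, 0)" using g True by (simp add: jump_free_def)
      ultimately show ?thesis using ex by metis
    qed (auto intro: zero_less_one)
    then obtain d' where d': "d' > 0"
      "\<And>q. fst p \<in> Q \<Longrightarrow> q \<in> split_nbhd (A \<union> Q) (fst p, 1) d' \<Longrightarrow> \<bar>val g q - val g p\<bar> < e" by blast
    have "\<bar>val f q - val f p\<bar> < e" if q: "q \<in> split_nbhd A p (min d d')" for q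
    proof -
      have "q \<in> split_nbhd (A \<union> Q) p d \<or> fst p \<in> Q \<and> q \<in> split_nbhd (A \<union> Q) (fst p, 1) d'"
        using q by (auto simp: split_nbhd_def split_points_def)
      moreover have "q \<in> split_points A" using q split_nbhd_subset by blast
      ultimately have "\<bar>val g q - val g p\<bar> < e" using d(2) d'(2) by blast
      with \<open>q \<in> split_points A\<close> p show ?thesis by (simp add: f)
    qed
    with d d' show "\<exists>\<delta>>0. \<forall>q\<in>split_nbhd A p \<delta>. \<bar>val f q - val f p\<bar> < e"
      by (intro exI[of _ "min d d'"]) auto
  qed (simp add: f)
  moreover have "?p f = g"
  proof (rule val_eqI)
    fix p
    show "val (?p f) p = val g p"
    proof (cases "p \<in> split_points (A \<union> Q)")
      case True
      then have "collapse Q p \<in> split_points A" using collapse_image[OF assms] by blast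
      with True show ?thesis by (simp add: apply_pullback f gc)
    next
      case False
      moreover have "g \<in> split_C (A \<union> Q)" using g by (simp add: jump_free_def)
      ultimately have "val g p = 0" unfolding split_C_iff by metis
      with False show ?thesis by (simp add: apply_pullback)
    qed
  qed
  ultimately show "g \<in> ?p ` C_space (order_top (split_line A))"
    unfolding split_C_def by (metis imageI)
qed

text \<open>
  All concrete functions on split lines have this form: \<open>\<psi>\<close> of the real coordinate up to \<open>(a,0)\<close>,
  and \<open>\<theta>\<close> of it afterwards.  Such a function is continuous if \<open>a\<close> is split or the two branches
  agree at \<open>a\<close>.
\<close>

definition glue :: "real set \<Rightarrow> real \<Rightarrow> (real \<Rightarrow> real) \<Rightarrow> (real \<Rightarrow> real)
    \<Rightarrow> ((real \<times> real) discrete \<Rightarrow>\<^sub>C real)" where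
  "glue B a \<psi> \<theta> = from_fun (\<lambda>p. if p \<notin> split_points B then 0
     else if fst p < a \<or> p = (a, 0) then \<psi> (fst p) else \<theta> (fst p))"

lemma val_glue:
  assumes "continuous_on {0..1} \<psi>" "continuous_on {0..1} \<theta>"
  shows "val (glue B a \<psi> \<theta>) p = (if p \<notin> split_points B then 0
     else if fst p < a \<or> p = (a, 0) then \<psi> (fst p) else \<theta> (fst p))"
proof -
  have "bounded (\<psi> ` {0..1})" "bounded (\<theta> ` {0..1})"
    using assms by (auto intro!: compact_imp_bounded compact_continuous_image)
  then obtain b c where bc: "\<And>x. x \<in> {0..1} \<Longrightarrow> \<bar>\<psi> x\<bar> \<le> b" "\<And>x. x \<in> {0..1} \<Longrightarrow> \<bar>\<theta> x\<bar> \<le> c"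
    unfolding bounded_iff real_norm_def by (metis imageI)
  have "\<bar>if p \<notin> split_points B then 0
     else if fst p < a \<or> p = (a, 0) then \<psi> (fst p) else \<theta> (fst p)\<bar> \<le> \<bar>b\<bar> + \<bar>c\<bar>" for p
  proof (cases "p \<in> split_points B")
    case True
    then have "fst p \<in> {0..1}" by (simp add: split_points_def)
    then have "\<bar>\<psi> (fst p)\<bar> \<le> \<bar>b\<bar> + \<bar>c\<bar>" "\<bar>\<theta> (fst p)\<bar> \<le> \<bar>b\<bar> + \<bar>c\<bar>"
      using bc[of "fst p"] by linarith+
    with True show ?thesis
      by (cases "fst p < a \<or> p = (a, 0)") (simp_all only: not_True_eq_False if_True if_False)
  qed simp
  then show ?thesis unfolding glue_def by (rule val_from_fun)
qed

lemma glue_in_split_C: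
  assumes c: "continuous_on {0..1} \<psi>" "continuous_on {0..1} \<theta>" and a: "a \<in> B \<or> \<psi> a = \<theta> a"
  shows "glue B a \<psi> \<theta> \<in> split_C B"
  unfolding split_C_iff
proof (intro conjI ballI allI impI)
  fix p and e :: real assume p: "p \<in> split_points B" and e: "e > 0"
  then have x: "fst p \<in> {0..1}" by (simp add: split_points_def)
  obtain d1 where d1: "d1 > 0" "\<And>y. y \<in> {0..1} \<Longrightarrow> \<bar>y - fst p\<bar> < d1 \<Longrightarrow> \<bar>\<psi> y - \<psi> (fst p)\<bar> < e"
    using c(1)[unfolded continuous_on_iff, rule_format, OF x e] by (auto simp: dist_real_def)
  obtain d2 where d2: "d2 > 0" "\<And>y. y \<in> {0..1} \<Longrightarrow> \<bar>y - fst p\<bar> < d2 \<Longrightarrow> \<bar>\<theta> y - \<theta> (fst p)\<bar> < e"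
    using c(2)[unfolded continuous_on_iff, rule_format, OF x e] by (auto simp: dist_real_def)
  define d where "d = min (min d1 d2) (if fst p = a then 1 else \<bar>fst p - a\<bar>)"
  have "d > 0" using d1 d2 by (simp add: d_def)
  moreover have "\<bar>val (glue B a \<psi> \<theta>) q - val (glue B a \<psi> \<theta>) p\<bar> < e" if q: "q \<in> split_nbhd B p d" for q
  proof -
    have qB: "q \<in> split_points B" "fst q \<in> {0..1}" using q by (auto simp: split_nbhd_def split_points_def)
    have near: "\<bar>fst q - fst p\<bar> < d" using q \<open>d > 0\<close> by (auto simp: split_nbhd_def)
    then have s: "\<bar>\<psi> (fst q) - \<psi> (fst p)\<bar> < e" "\<bar>\<theta> (fst q) - \<theta> (fst p)\<bar> < e"
      using d1(2) d2(2) qB(2) by (auto simp: d_def)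
    consider "fst p < a" | "fst p > a" | "fst p = a" by linarith
    then show ?thesis
    proof cases
      case 1
      then have "fst q < a" using near by (auto simp: d_def)
      with 1 s p qB show ?thesis by (simp add: val_glue[OF c])
    next
      case 2
      then have "fst q > a" using near by (auto simp: d_def)
      with 2 s p qB show ?thesis by (auto simp: val_glue[OF c])
    next
      case 3
      with q p a have "q = p \<or> (fst q < a \<and> p = (a, 0)) \<or> (fst q > a \<and> (p \<noteq> (a, 0) \<or> \<psi> a = \<theta> a))"
        by (auto simp: split_nbhd_def split_points_def prod_eq_iff)
      with 3 s p qB e show ?thesis by (auto simp: val_glue[OF c])
    qed
  qed
  ultimately show "\<exists>\<delta>>0. \<forall>q\<in>split_nbhd B p \<delta>.
      \<bar>val (glue B a \<psi> \<theta>) q - val (glue B a \<psi> \<theta>) p\<bar> < e" by blast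
qed (simp add: val_glue[OF c])

lemma glue_no_jump:
  assumes c: "continuous_on {0..1} \<psi>" "continuous_on {0..1} \<theta>" and "q \<in> B" "q \<noteq> a \<or> \<psi> a = \<theta> a"
  shows "val (glue B a \<psi> \<theta>) (q, 1) = val (glue B a \<psi> \<theta>) (q, 0)"
proof (cases "0 \<le> q \<and> q \<le> 1")
  case True
  then have "(q, 1) \<in> split_points B" "(q, 0) \<in> split_points B"
    using assms by (auto simp: split_points_def)
  then show ?thesis using assms(4) by (auto simp: val_glue[OF c])
qed (auto simp: val_glue[OF c] split_points_def)

lemma glue_in_jump_free:
  assumes "continuous_on {0..1} \<psi>" "continuous_on {0..1} \<theta>" "Q \<subseteq> B"
    and "a \<in> B - Q \<or> \<psi> a = \<theta> a"
  shows "glue B a \<psi> \<theta> \<in> jump_free B Q"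
  unfolding jump_free_def
proof (intro CollectI conjI ballI)
  show "glue B a \<psi> \<theta> \<in> split_C B"
    using assms by (intro glue_in_split_C) auto
  fix q assume "q \<in> Q"
  then show "val (glue B a \<psi> \<theta>) (q, 1) = val (glue B a \<psi> \<theta>) (q, 0)"
    using assms by (intro glue_no_jump) auto
qed



section \<open>Bounded functionals, ramps and cut values\<close>

definition functional_on :: "'a::real_normed_vector set \<Rightarrow> real \<Rightarrow> ('a \<Rightarrow> real) \<Rightarrow> bool" where
  "functional_on Y M \<Lambda> \<longleftrightarrow> (\<forall>f\<in>Y. \<forall>g\<in>Y. \<Lambda> (f + g) = \<Lambda> f + \<Lambda> g)
     \<and> (\<forall>c. \<forall>f\<in>Y. \<Lambda> (c *\<^sub>R f) = c * \<Lambda> f) \<and> (\<forall>f\<in>Y. \<bar>\<Lambda> f\<bar> \<le> M * norm f)"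

lemma functional_on_diff:
  assumes "functional_on Y M \<Lambda>" "subspace Y" "f \<in> Y" "g \<in> Y"
  shows "\<Lambda> (f - g) = \<Lambda> f - \<Lambda> g"
proof -
  have m: "(-1) *\<^sub>R g \<in> Y" using assms by (blast intro: subspace_scale)
  have "\<Lambda> (f + (-1) *\<^sub>R g) = \<Lambda> f + \<Lambda> ((-1) *\<^sub>R g)"
    using assms m unfolding functional_on_def by blast
  also have "\<Lambda> ((-1) *\<^sub>R g) = (-1) * \<Lambda> g"
    using assms unfolding functional_on_def by blast
  finally show ?thesis by simp
qed

lemma functional_on_lincomb:
  assumes \<Lambda>: "functional_on Y M \<Lambda>" and "subspace Y" "finite J" "\<And>q. q \<in> J \<Longrightarrow> g q \<in> Y"
  shows "\<Lambda> (\<Sum>q\<in>J. c q *\<^sub>R g q) = (\<Sum>q\<in>J. c q * \<Lambda> (g q))"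
  using assms(3,4)
proof (induction J rule: finite_induct)
  case empty
  then show ?case using functional_on_diff[OF \<Lambda> assms(2), of 0 0] subspace_0[OF assms(2)] by simp
next
  case (insert q J)
  then have "c q *\<^sub>R g q \<in> Y" "(\<Sum>q\<in>J. c q *\<^sub>R g q) \<in> Y"
    using assms(2) by (auto intro: subspace_scale subspace_sum)
  then have "\<Lambda> (c q *\<^sub>R g q + (\<Sum>q\<in>J. c q *\<^sub>R g q)) = \<Lambda> (c q *\<^sub>R g q) + \<Lambda> (\<Sum>q\<in>J. c q *\<^sub>R g q)"
    using \<Lambda> unfolding functional_on_def by blast
  moreover have "\<Lambda> (c q *\<^sub>R g q) = c q * \<Lambda> (g q)"
    using \<Lambda> insert.prems unfolding functional_on_def by blast
  ultimately show ?case using insert by simp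
qed

text \<open>
  Continuous approximations from above to the indicator of the points over \<open>{..t}\<close>.  Being constantly
  1 on a whole interval to the right of \<open>t\<close> makes the difference of two ramps vanish near \<open>t\<close>, which
  leaves room for ramps of smaller width.
\<close>

definition is_ramp :: "real set \<Rightarrow> real set \<Rightarrow> real \<Rightarrow> real
    \<Rightarrow> ((real \<times> real) discrete \<Rightarrow>\<^sub>C real) \<Rightarrow> bool" where
  "is_ramp B Q t \<delta> g \<longleftrightarrow> g \<in> jump_free B Q \<and> (\<forall>p. 0 \<le> val g p \<and> val g p \<le> 1) \<and>
     (\<exists>\<eta>>0. \<forall>p\<in>split_points B.
        (fst p \<le> t + \<eta> \<longrightarrow> val g p = 1) \<and> (t + \<delta> \<le> fst p \<longrightarrow> val g p = 0))"

lemma is_ramp_mono: "is_ramp B Q t \<delta> g \<Longrightarrow> \<delta> \<le> \<delta>' \<Longrightarrow> is_ramp B Q t \<delta>' g"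
  unfolding is_ramp_def by (meson add_left_mono order_trans)

definition ramp :: "real set \<Rightarrow> real \<Rightarrow> real \<Rightarrow> ((real \<times> real) discrete \<Rightarrow>\<^sub>C real)" where
  "ramp B t \<delta> = (let r = (\<lambda>x. max 0 (min 1 (2 - 3 * (x - t) / \<delta>))) in glue B 0 r r)"

lemma is_ramp_ramp:
  assumes "\<delta> > 0" "Q \<subseteq> B"
  shows "is_ramp B Q t \<delta> (ramp B t \<delta>)"
proof -
  define r where "r x = max 0 (min 1 (2 - 3 * (x - t) / \<delta>))" for x
  have c: "continuous_on {0..1} r" unfolding r_def using assms by (intro continuous_intros) auto
  have ramp: "ramp B t \<delta> = glue B 0 r r" by (simp only: ramp_def Let_def r_def[abs_def])
  have v: "val (ramp B t \<delta>) p = (if p \<in> split_points B then r (fst p) else 0)" for p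
    by (simp add: ramp val_glue[OF c c])
  have "ramp B t \<delta> \<in> jump_free B Q"
    unfolding ramp using assms c by (intro glue_in_jump_free) auto
  moreover have "0 \<le> val (ramp B t \<delta>) p \<and> val (ramp B t \<delta>) p \<le> 1" for p
    by (simp add: v r_def)
  \<comment> \<open>r falls linearly on the middle third of [t, t + \<delta>].\<close>
  moreover have "(x \<le> t + \<delta>/3 \<longrightarrow> r x = 1) \<and> (t + \<delta> \<le> x \<longrightarrow> r x = 0)" for x
    using assms(1) by (auto simp: r_def field_simps max_def min_def)
  ultimately show ?thesis
    unfolding is_ramp_def using assms(1) by (auto simp: v intro!: exI[of _ "\<delta>/3"])
qed

text \<open>
  Cuts at split points outside \<open>Q\<close> are themselves ramps for nearby points \<open>t\<close> on their left.
  This is how the points of \<open>A\<close> influence the cut values elsewhere.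
\<close>

lemma is_ramp_cut:
  assumes "Q \<subseteq> B" "a \<in> B - Q" "t < a" "a < t + \<delta>"
  shows "is_ramp B Q t \<delta> (glue B a (\<lambda>_. 1) (\<lambda>_. 0))"
  unfolding is_ramp_def
proof (intro conjI exI[of _ "(a - t) / 2"])
  show "glue B a (\<lambda>_. 1) (\<lambda>_. 0) \<in> jump_free B Q"
    using assms by (intro glue_in_jump_free) auto
qed (use assms in \<open>auto simp: val_glue field_simps\<close>)

text \<open>
  A gliding hump argument: if \<open>\<Lambda>\<close> separated ramps of arbitrarily small width by \<open>\<epsilon>\<close>, one could
  add up \<open>N\<close> differences of ramps with disjoint supports, each contributing at least \<open>\<epsilon>\<close>.  Their
  sum has norm at most 1, while \<open>\<Lambda>\<close> takes a value of at least \<open>N \<epsilon>\<close> on it.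
\<close>

lemma ramp_oscillation:
  assumes \<Lambda>: "functional_on (jump_free B Q) M \<Lambda>" and "\<epsilon> > 0"
  shows "\<exists>\<delta>>0. \<forall>g g'. is_ramp B Q t \<delta> g \<longrightarrow> is_ramp B Q t \<delta> g' \<longrightarrow> \<bar>\<Lambda> g - \<Lambda> g'\<bar> \<le> \<epsilon>"
proof (rule ccontr)
  let ?Y = "jump_free B Q"
  assume neg: "\<not> ?thesis"
  have pair: "\<exists>g g'. is_ramp B Q t \<delta> g \<and> is_ramp B Q t \<delta> g' \<and> \<epsilon> < \<Lambda> g - \<Lambda> g'" if d: "\<delta> > 0" for \<delta>
  proof -
    obtain g g' where g: "is_ramp B Q t \<delta> g" "is_ramp B Q t \<delta> g'" "\<not> \<bar>\<Lambda> g - \<Lambda> g'\<bar> \<le> \<epsilon>"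
      using neg d by blast
    then consider "\<epsilon> < \<Lambda> g - \<Lambda> g'" | "\<epsilon> < \<Lambda> g' - \<Lambda> g" by linarith
    then show ?thesis using g by cases blast+
  qed
  \<comment> \<open>The gap \<eta> to the right of t is where the next difference will be placed.\<close>
  have "\<exists>d\<in>?Y. (\<forall>p. \<bar>val d p\<bar> \<le> 1 \<and> (t + \<delta> \<le> fst p \<longrightarrow> val d p = 0)) \<and>
      (\<exists>\<eta>>0. \<forall>p. fst p \<le> t + \<eta> \<longrightarrow> val d p = 0) \<and> real N * \<epsilon> \<le> \<Lambda> d" if "\<delta> > 0" for \<delta> N
    using that
  proof (induction N arbitrary: \<delta>)
    case 0
    have "\<Lambda> 0 = 0"
      using functional_on_diff[OF \<Lambda> subspace_jump_free, of 0 0] subspace_0[OF subspace_jump_free[of B Q]]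
      by simp
    then show ?case
      using subspace_0[OF subspace_jump_free[of B Q]] by (intro bexI[of _ 0]) (auto intro: zero_less_one)
  next
    case (Suc N)
    obtain g g' where g: "is_ramp B Q t \<delta> g" "is_ramp B Q t \<delta> g'" "\<epsilon> < \<Lambda> g - \<Lambda> g'"
      using pair[OF Suc.prems] by blast
    have out: "val h p = 0" if "is_ramp B Q t \<delta> h" "p \<notin> split_points B" for h p
    proof -
      have "h \<in> split_C B" using that(1) by (simp add: is_ramp_def jump_free_def)
      with that(2) show ?thesis unfolding split_C_iff by metis
    qed
    obtain e1 where e1: "e1 > 0" "\<And>p. p \<in> split_points B \<Longrightarrow>
        (fst p \<le> t + e1 \<longrightarrow> val g p = 1) \<and> (t + \<delta> \<le> fst p \<longrightarrow> val g p = 0)"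
      using g(1) unfolding is_ramp_def by blast
    obtain e2 where e2: "e2 > 0" "\<And>p. p \<in> split_points B \<Longrightarrow>
        (fst p \<le> t + e2 \<longrightarrow> val g' p = 1) \<and> (t + \<delta> \<le> fst p \<longrightarrow> val g' p = 0)"
      using g(2) unfolding is_ramp_def by blast
    define e where "e = min (min e1 e2) \<delta>"
    have "e > 0" using e1 e2 Suc.prems by (simp add: e_def)
    have gg: "val g p - val g' p = 0" if "fst p \<le> t + e \<or> t + \<delta> \<le> fst p" for p
    proof (cases "p \<in> split_points B")
      case True
      then show ?thesis using e1(2)[of p] e2(2)[of p] that by (auto simp: e_def)
    next
      case False
      then show ?thesis using out g(1,2) by simp
    qed
    obtain d where d: "d \<in> ?Y" "\<And>p. \<bar>val d p\<bar> \<le> 1" "\<And>p. t + e \<le> fst p \<Longrightarrow> val d p = 0"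
      "\<exists>\<eta>>0. \<forall>p. fst p \<le> t + \<eta> \<longrightarrow> val d p = 0" "real N * \<epsilon> \<le> \<Lambda> d"
      using Suc.IH[OF \<open>e > 0\<close>] by blast
    obtain \<eta> where \<eta>: "\<eta> > 0" "\<And>p. fst p \<le> t + \<eta> \<Longrightarrow> val d p = 0" using d(4) by blast
    have Y: "g \<in> ?Y" "g' \<in> ?Y" using g by (auto simp: is_ramp_def)
    then have gY: "g - g' \<in> ?Y" by (rule subspace_diff[OF subspace_jump_free])
    show ?case
    proof (intro bexI[of _ "d + (g - g')"] conjI allI impI exI[of _ "min \<eta> e"])
      fix p
      have "\<bar>val g p - val g' p\<bar> \<le> 1"
        using g(1,2) unfolding is_ramp_def by (smt (verit))
      then show "\<bar>val (d + (g - g')) p\<bar> \<le> 1"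
        using gg[of p] d(2)[of p] d(3)[of p] by (cases "fst p \<le> t + e") auto
      show "val (d + (g - g')) p = 0" if "t + \<delta> \<le> fst p"
        using gg[of p] d(3)[of p] that by (auto simp: e_def)
      show "val (d + (g - g')) p = 0" if "fst p \<le> t + min \<eta> e"
      proof -
        have "fst p \<le> t + \<eta>" "fst p \<le> t + e" using that by linarith+
        then show ?thesis using gg[of p] \<eta>(2)[of p] by simp
      qed
    next
      have "\<Lambda> (d + (g - g')) = \<Lambda> d + \<Lambda> (g - g')"
        using \<Lambda> d(1) gY unfolding functional_on_def by blast
      also have "\<Lambda> (g - g') = \<Lambda> g - \<Lambda> g'" by (rule functional_on_diff[OF \<Lambda> subspace_jump_free Y])
      finally show "real (Suc N) * \<epsilon> \<le> \<Lambda> (d + (g - g'))"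
        using d(5) g(3) by (simp add: algebra_simps)
      show "d + (g - g') \<in> ?Y" using d(1) gY by (rule subspace_add[OF subspace_jump_free])
    qed (use \<eta> \<open>e > 0\<close> in auto)
  qed
  then have "\<exists>d\<in>?Y. (\<forall>p. \<bar>val d p\<bar> \<le> 1) \<and> real N * \<epsilon> \<le> \<Lambda> d" for N
    using zero_less_one by blast
  moreover have "\<Lambda> d \<le> \<bar>M\<bar>" if "d \<in> ?Y" "\<forall>p. \<bar>val d p\<bar> \<le> 1" for d
  proof -
    have "norm d \<le> 1" using that by (intro norm_le_valI) auto
    then have "\<bar>M\<bar> * norm d \<le> \<bar>M\<bar> * 1" by (intro mult_left_mono) auto
    moreover have "M * norm d \<le> \<bar>M\<bar> * norm d" by (intro mult_right_mono) auto
    moreover have "\<bar>\<Lambda> d\<bar> \<le> M * norm d" using \<Lambda> that(1) unfolding functional_on_def by blast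
    ultimately show ?thesis by linarith
  qed
  ultimately have "real N * \<epsilon> \<le> \<bar>M\<bar>" for N by (meson order_trans)
  moreover obtain N where "\<bar>M\<bar> < real N * \<epsilon>" using reals_Archimedean3[OF \<open>\<epsilon> > 0\<close>] by blast
  ultimately show False by (meson not_less)
qed

text \<open>
  If \<open>\<Lambda>\<close> is integration against a signed measure, this is the measure of the points over
  \<open>{..t}\<close>, that is, its distribution function at \<open>t\<close>.
\<close>

definition cut_value :: "real set \<Rightarrow> (((real \<times> real) discrete \<Rightarrow>\<^sub>C real) \<Rightarrow> real) \<Rightarrow> real \<Rightarrow> real" where
  "cut_value B \<Lambda> t = lim (\<lambda>k. \<Lambda> (ramp B t (1 / (real k + 1))))"

lemma cut_value_approx:
  assumes \<Lambda>: "functional_on (jump_free B Q) M \<Lambda>" and "Q \<subseteq> B" "\<epsilon> > 0"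
  shows "\<exists>\<delta>>0. \<forall>g. is_ramp B Q t \<delta> g \<longrightarrow> \<bar>\<Lambda> g - cut_value B \<Lambda> t\<bar> \<le> \<epsilon>"
proof -
  let ?L = "\<lambda>k. \<Lambda> (ramp B t (1 / (real k + 1)))"
  have small: "\<exists>N. \<forall>k\<ge>N. is_ramp B Q t \<delta> (ramp B t (1 / (real k + 1)))" if \<delta>: "\<delta> > 0" for \<delta>
  proof -
    obtain N where N: "1 / (real N + 1) < \<delta>"
      using reals_Archimedean[OF \<delta>] by (auto simp: inverse_eq_divide add.commute)
    have "1 / (real k + 1) \<le> \<delta>" if "k \<ge> N" for k
    proof -
      have "1 / (real k + 1) \<le> 1 / (real N + 1)" using that by (intro divide_left_mono) auto
      with N show ?thesis by linarith
    qed
    moreover have "is_ramp B Q t (1 / (real k + 1)) (ramp B t (1 / (real k + 1)))" for k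
      using assms(2) by (intro is_ramp_ramp) auto
    ultimately show ?thesis using is_ramp_mono by blast
  qed
  have "Cauchy ?L"
    unfolding Cauchy_def
  proof (intro allI impI)
    fix e :: real assume "e > 0"
    then obtain d where d: "d > 0" "\<And>g g'. is_ramp B Q t d g \<Longrightarrow> is_ramp B Q t d g' \<Longrightarrow> \<bar>\<Lambda> g - \<Lambda> g'\<bar> \<le> e/2"
      using ramp_oscillation[OF \<Lambda>, of "e/2" t] by auto
    obtain N where "\<forall>k\<ge>N. is_ramp B Q t d (ramp B t (1 / (real k + 1)))" using small[OF d(1)] by blast
    then have "\<bar>?L m - ?L n\<bar> \<le> e/2" if "m \<ge> N" "n \<ge> N" for m n using d(2) that by blast
    with \<open>e > 0\<close> show "\<exists>M. \<forall>m\<ge>M. \<forall>n\<ge>M. dist (?L m) (?L n) < e"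
      unfolding dist_real_def by (intro exI[of _ N]) (smt (verit) field_sum_of_halves)
  qed
  then have lim: "?L \<longlonglongrightarrow> cut_value B \<Lambda> t"
    unfolding cut_value_def by (simp add: Cauchy_convergent_iff convergent_LIMSEQ_iff)
  obtain d where d: "d > 0" "\<And>g g'. is_ramp B Q t d g \<Longrightarrow> is_ramp B Q t d g' \<Longrightarrow> \<bar>\<Lambda> g - \<Lambda> g'\<bar> \<le> \<epsilon>"
    using ramp_oscillation[OF \<Lambda> \<open>\<epsilon> > 0\<close>, of t] by blast
  obtain N where N: "\<forall>k\<ge>N. is_ramp B Q t d (ramp B t (1 / (real k + 1)))" using small[OF d(1)] by blast
  have "\<bar>\<Lambda> g - cut_value B \<Lambda> t\<bar> \<le> \<epsilon>" if "is_ramp B Q t d g" for g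
  proof (rule LIMSEQ_le_const2)
    show "(\<lambda>k. \<bar>\<Lambda> g - ?L k\<bar>) \<longlonglongrightarrow> \<bar>\<Lambda> g - cut_value B \<Lambda> t\<bar>"
      by (intro tendsto_intros lim)
    show "\<exists>N. \<forall>n\<ge>N. \<bar>\<Lambda> g - ?L n\<bar> \<le> \<epsilon>" using d(2)[OF that] N by blast
  qed
  with d(1) show ?thesis by blast
qed

section \<open>Where cut values fail to tend to zero\<close>

text \<open>
  A point of the difference is the left end of an interval whose interior contains no other such
  point.  So these intervals are disjoint, and a rational number in each of them tells the points apart.
\<close>

lemma countable_left_endpoints:
  fixes W :: "(real \<times> real) set"
  shows "countable ((\<Union>(t, d)\<in>W. {t..<t+d}) - (\<Union>(t, d)\<in>W. {t<..<t+d}))"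
proof -
  define E where "E = (\<Union>(t, d)\<in>W. {t..<t+d}) - (\<Union>(t, d)\<in>W. {t<..<t+d})"
  have outside: "y \<notin> {t<..<t+d}" if "y \<in> E" "(t, d) \<in> W" for y t d
    using that unfolding E_def by blast
  have "\<exists>d. (x, d) \<in> W \<and> d > 0" if x: "x \<in> E" for x
  proof -
    obtain t d where td: "(t, d) \<in> W" "x \<in> {t..<t+d}" using x unfolding E_def by blast
    moreover have "x \<notin> {t<..<t+d}" using outside[OF x td(1)] .
    ultimately have "x = t" by auto
    with td show ?thesis by auto
  qed
  then obtain D where D: "\<And>x. x \<in> E \<Longrightarrow> (x, D x) \<in> W \<and> D x > 0" by metis
  have "\<exists>r\<in>\<rat>. x < r \<and> r < x + D x" if "x \<in> E" for x
    using D[OF that] by (intro Rats_dense_in_real) simp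
  then obtain r where r: "\<And>x. x \<in> E \<Longrightarrow> r x \<in> \<rat> \<and> x < r x \<and> r x < x + D x" by metis
  have sep: "x + D x \<le> y" if xy: "x \<in> E" "y \<in> E" "x < y" for x y
  proof (rule ccontr)
    assume "\<not> ?thesis"
    then have "y \<in> {x<..<x + D x}" using xy by simp
    then show False using D[OF xy(1)] outside[OF xy(2)] by blast
  qed
  have "inj_on r E"
  proof (rule linorder_inj_onI)
    fix x y assume "x < y" and xy: "x \<in> E" "y \<in> E"
    then show "r x \<noteq> r y" using sep[OF xy] r[OF xy(1)] r[OF xy(2)] by linarith
  qed auto
  moreover have "countable (r ` E)"
    by (rule countable_subset[OF _ countable_rat]) (use r in blast)
  ultimately show ?thesis unfolding E_def by (rule countable_image_inj_on[rotated])
qed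

text \<open>
  For fixed \<open>n\<close> and a bound \<open>1/(k+1)\<close>, call \<open>(t,d)\<close> bad if \<open>\<bar>\<Lambda>\<^sub>n\<bar>\<close> exceeds the bound on all ramps of
  width \<open>d\<close> at \<open>t\<close>.  If \<open>t\<close> has a large cut value then \<open>(t,d)\<close> is bad for some \<open>d\<close>.
  The sets \<open>V k m\<close> collect the open intervals \<open>]t,t+d[\<close> over all \<open>n \<ge> m\<close>, at the price of countably
  many left endpoints.  A split point \<open>a\<close> outside \<open>Q\<close> in infinitely many bad intervals is impossible,
  since its cut is a ramp there and \<open>\<Lambda>\<^sub>n\<close> tends to 0 on it.
\<close>

lemma exceptional_cuts:
  fixes \<Lambda> :: "nat \<Rightarrow> ((real \<times> real) discrete \<Rightarrow>\<^sub>C real) \<Rightarrow> real"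
  assumes \<Lambda>: "\<And>n. functional_on (jump_free B Q) M (\<Lambda> n)"
    and null: "\<And>f. f \<in> jump_free B Q \<Longrightarrow> (\<lambda>n. \<Lambda> n f) \<longlonglongrightarrow> 0" and "Q \<subseteq> B"
  obtains V :: "nat \<Rightarrow> nat \<Rightarrow> real set" and C where "\<And>k m. open (V k m)"
    "\<And>k. (\<Inter>m. V k m) \<inter> (B - Q) = {}" "countable C"
    "{t. \<not> (\<lambda>n. cut_value B (\<Lambda> n) t) \<longlonglongrightarrow> 0} \<subseteq> (\<Union>k. \<Inter>m. V k m) \<union> C"
proof -
  define W where "W n k = {(t, d). \<forall>g. is_ramp B Q t d g \<longrightarrow> 1 / (real k + 1) < \<bar>\<Lambda> n g\<bar>}" for n k
  define V where "V k m = (\<Union>n\<in>{m..}. \<Union>(t, d)\<in>W n k. {t<..<t+d})" for k m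
  define C where "C = (\<Union>n k. (\<Union>(t, d)\<in>W n k. {t..<t+d}) - (\<Union>(t, d)\<in>W n k. {t<..<t+d}))"
  show thesis
  proof
    show "open (V k m)" for k m unfolding V_def by (auto intro!: open_UN)
    show "countable C" unfolding C_def by (intro countable_UN countable_left_endpoints) auto
    show "(\<Inter>m. V k m) \<inter> (B - Q) = {}" for k
    proof (rule ccontr)
      assume "\<not> ?thesis"
      then obtain a where a: "a \<in> B - Q" "\<And>m. a \<in> V k m" by blast
      let ?g = "glue B a (\<lambda>_. 1) (\<lambda>_. 0)"
      have "?g \<in> jump_free B Q" using assms(3) a(1) by (intro glue_in_jump_free) auto
      from null[OF this] have "eventually (\<lambda>n. \<bar>\<Lambda> n ?g\<bar> < 1 / (real k + 1)) sequentially"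
        by (auto simp: tendsto_iff dist_real_def)
      then obtain m where m: "\<And>n. n \<ge> m \<Longrightarrow> \<bar>\<Lambda> n ?g\<bar> < 1 / (real k + 1)"
        by (auto simp: eventually_sequentially)
      obtain n t d where n: "n \<ge> m" "(t, d) \<in> W n k" "t < a" "a < t + d"
        using a(2)[of m] by (auto simp: V_def)
      then have "1 / (real k + 1) < \<bar>\<Lambda> n ?g\<bar>"
        using is_ramp_cut[OF assms(3) a(1), of t d] by (auto simp: W_def)
      with m[OF n(1)] show False by simp
    qed
    show "{t. \<not> (\<lambda>n. cut_value B (\<Lambda> n) t) \<longlonglongrightarrow> 0} \<subseteq> (\<Union>k. \<Inter>m. V k m) \<union> C"
    proof
      fix t assume "t \<in> {t. \<not> (\<lambda>n. cut_value B (\<Lambda> n) t) \<longlonglongrightarrow> 0}"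
      then obtain e where e: "e > 0" "\<And>m. \<exists>n\<ge>m. e \<le> \<bar>cut_value B (\<Lambda> n) t\<bar>"
        unfolding LIMSEQ_iff by (auto simp: not_less)
      obtain k where k: "1 / (real k + 1) < e"
        using reals_Archimedean[OF e(1)] by (auto simp: inverse_eq_divide add.commute)
      define c where "c = 1 / (real k + 1)"
      have W: "\<exists>d>0. (t, d) \<in> W n k" if n: "e \<le> \<bar>cut_value B (\<Lambda> n) t\<bar>" for n
      proof -
        define h where "h = (e - c) / 2"
        have "c < e" using k by (simp add: c_def)
        then have h: "h > 0" "c = e - 2 * h" using h_def by (simp_all add: field_simps)
        obtain d where "d > 0" "\<And>g. is_ramp B Q t d g \<Longrightarrow> \<bar>\<Lambda> n g - cut_value B (\<Lambda> n) t\<bar> \<le> h"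
          using cut_value_approx[OF \<Lambda>[of n] assms(3) h(1), of t] by blast
        moreover have "c < \<bar>x\<bar>" if "\<bar>x - cut_value B (\<Lambda> n) t\<bar> \<le> h" for x
        proof -
          have "\<bar>cut_value B (\<Lambda> n) t\<bar> \<le> \<bar>x\<bar> + \<bar>x - cut_value B (\<Lambda> n) t\<bar>"
            by linarith
          then show ?thesis using that n h by linarith
        qed
        ultimately show ?thesis unfolding W_def c_def by blast
      qed
      show "t \<in> (\<Union>k. \<Inter>m. V k m) \<union> C"
      proof (cases "t \<in> C")
        case False
        have "t \<in> V k m" for m
        proof -
          obtain n where n: "n \<ge> m" "e \<le> \<bar>cut_value B (\<Lambda> n) t\<bar>" using e(2) by blast
          then obtain d where "d > 0" "(t, d) \<in> W n k" using W by blast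
          then have "t \<in> (\<Union>(t, d)\<in>W n k. {t..<t+d})" by force
          then have "t \<in> (\<Union>(t, d)\<in>W n k. {t<..<t+d})" using False unfolding C_def by blast
          with n(1) show ?thesis unfolding V_def by blast
        qed
        then show ?thesis by blast
      qed simp
    qed
  qed
qed



section \<open>Density and extension by continuity\<close>

text \<open>
  Near every \<open>x\<close> the function is within \<open>e\<close> of a step function with its only step at \<open>x\<close>.
  A finite partition of unity in the real coordinate pastes these steps together, and it adds no
  jumps of its own.
\<close>

lemma finitely_many_jumps_dense:
  assumes "Q \<subseteq> B"
  shows "split_C B \<subseteq> closure {f \<in> split_C B. finite {q\<in>Q. val f (q, 1) \<noteq> val f (q, 0)}}"
proof
  fix f assume f: "f \<in> split_C B"
  have "\<exists>h\<in>{f \<in> split_C B. finite {q\<in>Q. val f (q, 1) \<noteq> val f (q, 0)}}. dist h f \<le> e" if e: "e > 0" for e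
  proof -
    define c where "c x = (if x \<in> B then val f (x, 1) else val f (x, 0))" for x
    define side where "side x p = (if fst p < x \<or> p = (x, 0) then val f (x, 0) else c x)"
      for x :: real and p :: "real \<times> real"
    have "\<exists>d>0. \<forall>p\<in>split_points B. \<bar>fst p - x\<bar> < d \<longrightarrow> \<bar>val f p - side x p\<bar> < e" if x: "x \<in> {0..1}" for x
    proof -
      define U where "U s = {p. \<bar>val f p - val f (x, s)\<bar> < e}" for s
      have "\<exists>\<delta>>0. split_nbhd B (x, s) \<delta> \<subseteq> U s" if s: "(x, s) \<in> split_points B" for s
      proof -
        have "\<exists>\<delta>>0. \<forall>q\<in>split_nbhd B (x, s) \<delta>. \<bar>val f q - val f (x, s)\<bar> < e"
          using f s e unfolding split_C_iff by metis
        then obtain d where "d > 0" "\<forall>q\<in>split_nbhd B (x, s) d. \<bar>val f q - val f (x, s)\<bar> < e" by blast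
        then show ?thesis unfolding U_def by (intro exI[of _ d]) auto
      qed
      then obtain d where d: "d > 0" "\<And>p. p \<in> split_points B \<Longrightarrow> \<bar>fst p - x\<bar> < d \<Longrightarrow>
           (if fst p < x \<or> x \<notin> B \<or> p = (x, 0) then p \<in> U 0 else p \<in> U 1)"
        using split_nbhd_around[of x B U] x by auto
      have "\<bar>val f p - side x p\<bar> < e" if p: "p \<in> split_points B" "\<bar>fst p - x\<bar> < d" for p
        using d(2)[OF p] by (auto simp: U_def side_def c_def split: if_splits)
      with d(1) show ?thesis by blast
    qed
    then obtain D where D: "\<And>x. x \<in> {0..1} \<Longrightarrow> D x > 0 \<and>
        (\<forall>p\<in>split_points B. \<bar>fst p - x\<bar> < D x \<longrightarrow> \<bar>val f p - side x p\<bar> < e)" by metis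
    have "{0..1::real} \<subseteq> (\<Union>x\<in>{0..1}. ball x (D x))" using D by force
    then obtain X where X: "X \<subseteq> {0..1}" "finite X" "{0..1} \<subseteq> (\<Union>x\<in>X. ball x (D x))"
      using compactE_image[OF compact_Icc, of "{0..1}" "\<lambda>x. ball x (D x)" 0 1]
      by (metis open_ball)
    \<comment> \<open>The partition of unity consists of normalized hat functions.\<close>
    define \<tau> where "\<tau> x y = max 0 (D x - \<bar>y - x\<bar>)" for x y :: real
    define \<psi> where "\<psi> x y = \<tau> x y / (\<Sum>x\<in>X. \<tau> x y)" for x y
    have \<tau>: "\<tau> x y \<ge> 0" "\<tau> x y \<noteq> 0 \<Longrightarrow> \<bar>y - x\<bar> < D x" for x y
      by (auto simp: \<tau>_def max_def split: if_splits)
    have pos: "(\<Sum>x\<in>X. \<tau> x y) > 0" if y01: "y \<in> {0..1}" for y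
    proof -
      obtain x where x: "x \<in> X" "\<bar>y - x\<bar> < D x"
        using X(3) y01 by (auto simp: dist_real_def abs_minus_commute)
      then have "0 < \<tau> x y" by (simp add: \<tau>_def)
      with x(1) X(2) \<tau>(1) show ?thesis by (intro sum_pos2[of X x]) auto
    qed
    have \<psi>: "\<psi> x y \<ge> 0" "\<psi> x y \<noteq> 0 \<Longrightarrow> \<bar>y - x\<bar> < D x" for x y
      using \<tau>[of x y] \<tau>(1) by (auto simp: \<psi>_def intro!: divide_nonneg_nonneg sum_nonneg)
    have sum1: "(\<Sum>x\<in>X. \<psi> x y) = 1" if "y \<in> {0..1}" for y
      using pos[OF that] by (simp add: \<psi>_def sum_divide_distrib[symmetric])
    have cont: "continuous_on {0..1} (\<lambda>y. k * \<psi> x y)" for k x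
      unfolding \<psi>_def \<tau>_def
      using pos by (intro continuous_intros ballI) (auto simp: \<tau>_def less_imp_neq[symmetric])
    define g where "g x = glue B x (\<lambda>y. val f (x, 0) * \<psi> x y) (\<lambda>y. c x * \<psi> x y)" for x
    have gC: "g x \<in> split_C B" for x
      unfolding g_def by (intro glue_in_split_C cont) (auto simp: c_def)
    define h where "h = (\<Sum>x\<in>X. g x)"
    have "h \<in> split_C B" unfolding h_def using gC by (intro subspace_sum[OF subspace_split_C])
    moreover have "val h (q, 1) = val h (q, 0)" if q: "q \<in> Q" "q \<notin> X" for q
    proof -
      have "val (g x) (q, 1) = val (g x) (q, 0)" if "x \<in> X" for x
        unfolding g_def using q that assms by (intro glue_no_jump cont) auto
      then show ?thesis by (simp add: h_def)
    qed
    then have "{q\<in>Q. val h (q, 1) \<noteq> val h (q, 0)} \<subseteq> X" by blast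
    then have "finite {q\<in>Q. val h (q, 1) \<noteq> val h (q, 0)}" using X(2) by (rule finite_subset)
    moreover have "dist h f \<le> e"
      unfolding dist_norm
    proof (rule norm_le_valI)
      fix p
      show "\<bar>val (h - f) p\<bar> \<le> e"
      proof (cases "p \<in> split_points B")
        case False
        then have "val (g x) p = 0" "val f p = 0" for x using gC[of x] f unfolding split_C_iff by metis+
        then show ?thesis using e by (simp add: h_def)
      next
        case True
        then have y: "fst p \<in> {0..1}" by (simp add: split_points_def)
        have vg: "val (g x) p = \<psi> x (fst p) * side x p" for x
          using True by (simp add: g_def val_glue[OF cont cont] side_def)
        have "val (h - f) p = (\<Sum>x\<in>X. \<psi> x (fst p) * side x p) - (\<Sum>x\<in>X. \<psi> x (fst p)) * val f p"
          by (simp add: h_def vg sum1[OF y])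
        also have "\<dots> = (\<Sum>x\<in>X. \<psi> x (fst p) * (side x p - val f p))"
          by (simp add: sum_distrib_right sum_subtractf[symmetric] right_diff_distrib)
        also have "\<bar>\<dots>\<bar> \<le> (\<Sum>x\<in>X. \<psi> x (fst p) * e)"
        proof (rule order_trans[OF sum_abs sum_mono])
          fix x assume x: "x \<in> X"
          show "\<bar>\<psi> x (fst p) * (side x p - val f p)\<bar> \<le> \<psi> x (fst p) * e"
          proof (cases "\<psi> x (fst p) = 0")
            case False
            then have "\<bar>val f p - side x p\<bar> < e" using \<psi>(2) D X(1) x True by blast
            then have "\<bar>side x p - val f p\<bar> \<le> e" by linarith
            then show ?thesis using \<psi>(1)[of x "fst p"] by (simp add: abs_mult mult_left_mono)
          qed simp
        qed
        also have "\<dots> = e" using sum1[OF y] by (simp add: sum_distrib_right[symmetric])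
        finally show ?thesis .
      qed
    qed
    ultimately show ?thesis by blast
  qed
  then show "f \<in> closure {f \<in> split_C B. finite {q\<in>Q. val f (q, 1) \<noteq> val f (q, 0)}}"
    unfolding closure_approachable_le by blast
qed

lemma closed_c0: "closed c0"
proof -
  have "s \<in> c0" if s: "s \<in> closure c0" for s
  proof -
    have "\<exists>N. \<forall>n\<ge>N. \<bar>apply_bcontfun s n\<bar> < e" if e: "e > 0" for e
    proof -
      obtain r where r: "r \<in> c0" "dist r s < e/2"
        using s e unfolding closure_approachable by (meson half_gt_zero)
      have "apply_bcontfun r \<longlonglongrightarrow> 0" using r(1) by (simp add: c0_def)
      then obtain N where N: "\<And>n. n \<ge> N \<Longrightarrow> \<bar>apply_bcontfun r n\<bar> < e/2"
        using LIMSEQ_D[of "apply_bcontfun r" 0 "e/2"] e by auto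
      have "\<bar>apply_bcontfun s n\<bar> < e" if "n \<ge> N" for n
      proof -
        have "dist (apply_bcontfun r n) (apply_bcontfun s n) < e/2"
          using r(2) dist_bounded le_less_trans by blast
        with N[OF that] show ?thesis unfolding dist_real_def by linarith
      qed
      then show ?thesis by blast
    qed
    then show ?thesis by (simp add: c0_def LIMSEQ_iff)
  qed
  then show ?thesis by (meson closure_subset_eq subsetI)
qed

text \<open>
  A uniform limit of bounded continuous functions is one, on an arbitrary topological domain;
  in particular for sequences, that is, for functions on the naturals.
\<close>

lemma closed_imp_complete_bcontfun:
  fixes Z :: "('a::topological_space \<Rightarrow>\<^sub>C 'b::complete_space) set"
  assumes "closed Z"
  shows "complete Z"
  unfolding complete_def
proof (intro allI impI)
  fix f assume f: "(\<forall>n. f n \<in> Z) \<and> Cauchy f"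
  then obtain g where "uniform_limit UNIV f g sequentially"
    using uniformly_convergent_eq_cauchy[of "\<lambda>_. True" f]
    unfolding Cauchy_def uniform_limit_sequentially_iff
    by (metis dist_fun_lt_imp_dist_val_lt)
  then obtain l where l: "f \<longlonglongrightarrow> l"
    using uniform_limit_bcontfunE[OF _ sequentially_bot] by metis
  have "l \<in> Z" by (rule closed_sequentially[OF assms _ l]) (use f in blast)
  with l show "\<exists>l\<in>Z. f \<longlonglongrightarrow> l" by (rule bexI)
qed

text \<open>
  Along a sequence in \<open>X\<close> that converges to a point of the closure the images form a Cauchy
  sequence in \<open>Z\<close>, and their limit does not depend on the sequence.
\<close>

lemma extend_operator_to_closure:
  fixes S :: "'a::real_normed_vector \<Rightarrow> 'b::real_normed_vector"
  assumes "subspace X" and S: "bounded_operator_on X S" and Z: "S ` X \<subseteq> Z" "complete Z"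
  obtains S' where "bounded_operator_on (closure X) S'" "S' ` closure X \<subseteq> Z" "\<And>x. x \<in> X \<Longrightarrow> S' x = S x"
proof -
  obtain C where C: "\<And>x. x \<in> X \<Longrightarrow> norm (S x) \<le> C * norm x"
    and add: "\<And>x y. x \<in> X \<Longrightarrow> y \<in> X \<Longrightarrow> S (x + y) = S x + S y"
    and scale: "\<And>a x. x \<in> X \<Longrightarrow> S (a *\<^sub>R x) = a *\<^sub>R S x"
    using S unfolding bounded_operator_on_def by blast
  have diff: "S (x - y) = S x - S y" if "x \<in> X" "y \<in> X" for x y
    using add[of x "(-1) *\<^sub>R y"] scale[of y "-1"] that subspace_scale[OF assms(1), of y "-1"] by simp
  have lip: "dist (S x) (S y) \<le> \<bar>C\<bar> * dist x y" if "x \<in> X" "y \<in> X" for x y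
  proof -
    have "norm (S (x - y)) \<le> C * norm (x - y)"
      using that by (intro C subspace_diff[OF assms(1)])
    also have "\<dots> \<le> \<bar>C\<bar> * norm (x - y)" by (intro mult_right_mono) auto
    finally show ?thesis by (simp add: dist_norm diff that)
  qed
  have cauchy: "Cauchy (\<lambda>n. S (u n))" if u: "\<And>n. u n \<in> X" "Cauchy u" for u
    unfolding Cauchy_def
  proof (intro allI impI)
    fix e :: real assume e: "e > 0"
    then have "e / (\<bar>C\<bar> + 1) > 0" by simp
    then obtain N where N: "\<And>m n. m \<ge> N \<Longrightarrow> n \<ge> N \<Longrightarrow> dist (u m) (u n) < e / (\<bar>C\<bar> + 1)"
      using u(2) unfolding Cauchy_def by blast
    have "dist (S (u m)) (S (u n)) < e" if "m \<ge> N" "n \<ge> N" for m n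
    proof -
      have "dist (S (u m)) (S (u n)) \<le> (\<bar>C\<bar> + 1) * dist (u m) (u n)"
        using lip[OF u(1,1), of m n] zero_le_dist[of "u m" "u n"] unfolding distrib_right by linarith
      also have "\<dots> < e" using N[OF that] by (simp add: field_simps)
      finally show ?thesis .
    qed
    then show "\<exists>N. \<forall>m\<ge>N. \<forall>n\<ge>N. dist (S (u m)) (S (u n)) < e" by blast
  qed
  have "\<exists>u z. x \<in> closure X \<longrightarrow> (\<forall>n. u n \<in> X) \<and> u \<longlonglongrightarrow> x \<and> z \<in> Z \<and> (\<lambda>n. S (u n)) \<longlonglongrightarrow> z" for x
  proof (cases "x \<in> closure X")
    case True
    then obtain u where u: "\<And>n. u n \<in> X" "u \<longlonglongrightarrow> x" using closure_sequential by metis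
    moreover obtain z where "z \<in> Z" "(\<lambda>n. S (u n)) \<longlonglongrightarrow> z"
      using completeE[OF Z(2) _ cauchy[OF u(1) LIMSEQ_imp_Cauchy[OF u(2)]]] Z(1) u(1) by blast
    ultimately show ?thesis by blast
  qed simp
  then obtain U S' where US: "\<And>x. x \<in> closure X \<Longrightarrow>
      (\<forall>n. U x n \<in> X) \<and> U x \<longlonglongrightarrow> x \<and> S' x \<in> Z \<and> (\<lambda>n. S (U x n)) \<longlonglongrightarrow> S' x" by metis
  have lim: "(\<lambda>n. S (u n)) \<longlonglongrightarrow> S' x" if u: "\<And>n. u n \<in> X" "u \<longlonglongrightarrow> x" for u x
  proof -
    have "x \<in> closure X" using u closure_sequential by blast
    note x = US[OF this]
    have "(\<lambda>n. \<bar>C\<bar> * dist (u n) (U x n)) \<longlonglongrightarrow> \<bar>C\<bar> * dist x x"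
      using u(2) x by (intro tendsto_intros) auto
    then have null: "(\<lambda>n. \<bar>C\<bar> * dist (u n) (U x n)) \<longlonglongrightarrow> 0" by simp
    have "norm (S (u n) - S (U x n)) \<le> \<bar>C\<bar> * dist (u n) (U x n)" for n
      using lip[of "u n" "U x n"] u(1) x by (simp add: dist_norm)
    then have "(\<lambda>n. S (u n) - S (U x n)) \<longlonglongrightarrow> 0"
      by (intro Lim_null_comparison[OF always_eventually null]) blast
    then have "(\<lambda>n. (S (u n) - S (U x n)) + S (U x n)) \<longlonglongrightarrow> 0 + S' x"
      using x by (intro tendsto_add) auto
    then show ?thesis by simp
  qed
  have ext: "S x = S' x" if "x \<in> X" for x
    using lim[of "\<lambda>_. x" x] that by (simp add: LIMSEQ_const_iff)
  have seq: "\<exists>u. (\<forall>n. u n \<in> X) \<and> u \<longlonglongrightarrow> x" if "x \<in> closure X" for x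
    using that by (simp add: closure_sequential)
  show thesis
  proof
    show "bounded_operator_on (closure X) S'"
      unfolding bounded_operator_on_def
    proof (intro conjI ballI allI exI)
      fix x y assume "x \<in> closure X" "y \<in> closure X"
      then obtain u v where u: "\<And>n. u n \<in> X" "u \<longlonglongrightarrow> x" and v: "\<And>n. v n \<in> X" "v \<longlonglongrightarrow> y"
        using seq by metis
      have "(\<lambda>n. S (u n + v n)) \<longlonglongrightarrow> S' (x + y)"
        using u v by (intro lim tendsto_add subspace_add[OF assms(1)])
      moreover have "(\<lambda>n. S (u n + v n)) \<longlonglongrightarrow> S' x + S' y"
        using tendsto_add[OF lim[OF u] lim[OF v]] by (simp add: add u(1) v(1))
      ultimately show "S' (x + y) = S' x + S' y" by (rule LIMSEQ_unique)
    next
      fix a x assume "x \<in> closure X"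
      then obtain u where u: "\<And>n. u n \<in> X" "u \<longlonglongrightarrow> x" using seq by metis
      have "(\<lambda>n. S (a *\<^sub>R u n)) \<longlonglongrightarrow> S' (a *\<^sub>R x)"
        using u by (intro lim tendsto_scaleR tendsto_const subspace_scale[OF assms(1)])
      moreover have "(\<lambda>n. S (a *\<^sub>R u n)) \<longlonglongrightarrow> a *\<^sub>R S' x"
        using tendsto_scaleR[OF tendsto_const lim[OF u], of a] by (simp add: scale u(1))
      ultimately show "S' (a *\<^sub>R x) = a *\<^sub>R S' x" by (rule LIMSEQ_unique)
    next
      fix x assume "x \<in> closure X"
      then obtain u where u: "\<And>n. u n \<in> X" "u \<longlonglongrightarrow> x" using seq by metis
      show "norm (S' x) \<le> C * norm x"
        by (rule LIMSEQ_le[OF tendsto_norm[OF lim[OF u]] tendsto_mult[OF tendsto_const tendsto_norm[OF u(2)]]])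
          (use C u(1) in blast)
    qed
    show "S' ` closure X \<subseteq> Z" using US by blast
  qed (simp add: ext)
qed



section \<open>Extending operators into c0\<close>

definition jump :: "((real \<times> real) discrete \<Rightarrow>\<^sub>C real) \<Rightarrow> real \<Rightarrow> real" where
  "jump f q = val f (q, 1) - val f (q, 0)"

definition cut_fun :: "real set \<Rightarrow> real \<Rightarrow> ((real \<times> real) discrete \<Rightarrow>\<^sub>C real)" where
  "cut_fun B q = glue B q (\<lambda>_. 1) (\<lambda>_. 0)"

text \<open>
  Since the jump of a cut at its own point is \<open>- 1\<close>, adding these multiples of cuts removes the jumps
  of \<open>f\<close> at the points of \<open>J\<close>.
\<close>

definition fill :: "real set \<Rightarrow> real set \<Rightarrow> ((real \<times> real) discrete \<Rightarrow>\<^sub>C real)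
    \<Rightarrow> ((real \<times> real) discrete \<Rightarrow>\<^sub>C real)" where
  "fill B J f = f + (\<Sum>q\<in>J. jump f q *\<^sub>R cut_fun B q)"

lemma jump_add: "jump (f + g) q = jump f q + jump g q"
  by (simp add: jump_def)

lemma jump_scaleR: "jump (a *\<^sub>R f) q = a * jump f q"
  by (simp add: jump_def right_diff_distrib)

lemma abs_jump_le: "\<bar>jump f q\<bar> \<le> 2 * norm f"
  using abs_val_le_norm[of f "(q, 1)"] abs_val_le_norm[of f "(q, 0)"] unfolding jump_def by linarith

lemma val_cut: "val (cut_fun B q) p = (if p \<in> split_points B \<and> (fst p < q \<or> p = (q, 0)) then 1 else 0)"
  by (simp add: cut_fun_def val_glue)

lemma jump_cut:
  assumes "q \<in> B \<inter> {0..1}" "q' \<in> B \<inter> {0..1}"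
  shows "jump (cut_fun B q) q' = (if q = q' then - 1 else 0)"
  using assms by (auto simp: jump_def val_cut split_points_def)

lemma fill_in_jump_free:
  assumes f: "f \<in> split_C B" and J: "finite J" "J \<subseteq> Q" and Q: "Q \<subseteq> B \<inter> {0..1}"
    and "\<And>q. q \<in> Q - J \<Longrightarrow> jump f q = 0"
  shows "fill B J f \<in> jump_free B Q"
proof -
  have "cut_fun B q \<in> split_C B" if "q \<in> J" for q
    using that J Q unfolding cut_fun_def by (intro glue_in_split_C) auto
  then have "fill B J f \<in> split_C B"
    unfolding fill_def using f subspace_split_C
    by (intro subspace_add subspace_sum subspace_scale) auto
  moreover have "val (fill B J f) (q', 1) = val (fill B J f) (q', 0)" if q': "q' \<in> Q" for q'
  proof -
    have "jump (fill B J f) q' = jump f q' + (\<Sum>q\<in>J. jump f q * jump (cut_fun B q) q')"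
      by (simp add: jump_def fill_def right_diff_distrib sum_subtractf)
    also have "(\<Sum>q\<in>J. jump f q * jump (cut_fun B q) q') = (\<Sum>q\<in>J. if q = q' then - jump f q else 0)"
    proof (rule sum.cong[OF refl])
      fix q assume "q \<in> J"
      then have "q \<in> B \<inter> {0..1}" "q' \<in> B \<inter> {0..1}" using J Q q' by blast+
      then show "jump f q * jump (cut_fun B q) q' = (if q = q' then - jump f q else 0)"
        by (simp add: jump_cut)
    qed
    also have "jump f q' + \<dots> = 0"
      using assms(5)[of q'] q' J(1) by (simp add: sum.delta)
    finally show ?thesis by (simp add: jump_def)
  qed
  ultimately show ?thesis by (simp add: jump_free_def)
qed

lemma finite_separation:
  fixes J :: "real set"
  assumes "finite J"
  shows "\<exists>d>0. \<forall>q\<in>J. \<forall>q'\<in>J. q \<noteq> q' \<longrightarrow> d \<le> \<bar>q - q'\<bar>"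
proof -
  define D where "D = insert 1 ((\<lambda>(q, q'). \<bar>q - q'\<bar>) ` (J \<times> J - Id))"
  have "finite D" using assms by (simp add: D_def)
  moreover have "\<forall>d\<in>D. d > 0" by (auto simp: D_def)
  ultimately have "Min D > 0" by (subst Min_gr_iff) (auto simp: D_def)
  moreover have "Min D \<le> \<bar>q - q'\<bar>" if "q \<in> J" "q' \<in> J" "q \<noteq> q'" for q q'
    using that \<open>finite D\<close> by (intro Min_le) (force simp: D_def)+
  ultimately show ?thesis by blast
qed

lemma finite_common_width:
  fixes D :: "'a \<Rightarrow> real"
  assumes "finite J" "\<And>q. q \<in> J \<Longrightarrow> D q > 0" "e > 0"
  shows "\<exists>d>0. d \<le> e \<and> (\<forall>q\<in>J. d \<le> D q)"
  using assms(1,2)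
proof (induction J rule: finite_induct)
  case empty
  then show ?case using assms(3) by blast
next
  case (insert q J)
  then obtain d where "d > 0" "d \<le> e" "\<forall>q\<in>J. d \<le> D q" by auto
  then show ?case using insert.prems[of q] by (intro exI[of _ "min d (D q)"]) auto
qed

lemma abs_sum_le_of_disjoint:
  fixes v :: "'a \<Rightarrow> real"
  assumes "finite J" "0 \<le> c" "\<And>q. q \<in> J \<Longrightarrow> \<bar>v q\<bar> \<le> c"
    and disj: "\<And>q q'. q \<in> J \<Longrightarrow> q' \<in> J \<Longrightarrow> v q \<noteq> 0 \<Longrightarrow> v q' \<noteq> 0 \<Longrightarrow> q = q'"
  shows "\<bar>sum v J\<bar> \<le> c"
proof (cases "\<exists>q\<in>J. v q \<noteq> 0")
  case True
  then obtain q where q: "q \<in> J" "v q \<noteq> 0" by blast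
  then have "sum v J = sum v {q}"
    using disj by (intro sum.mono_neutral_right assms(1)) auto
  then show ?thesis using assms(3) q by simp
next
  case False
  then show ?thesis using assms(2) by simp
qed

lemma cut_minus_ramp:
  assumes r: "is_ramp B Q q d g" and "q \<in> B" "d > 0"
  shows "\<bar>val (cut_fun B q) p - val g p\<bar> \<le> 1"
    and "val (cut_fun B q) p \<noteq> val g p \<Longrightarrow> q \<le> fst p \<and> fst p < q + d"
proof -
  have g: "0 \<le> val g p" "val g p \<le> 1" using r unfolding is_ramp_def by blast+
  then show "\<bar>val (cut_fun B q) p - val g p\<bar> \<le> 1" by (simp add: val_cut)
  obtain e where e: "e > 0" "\<And>p. p \<in> split_points B \<Longrightarrow>
      (fst p \<le> q + e \<longrightarrow> val g p = 1) \<and> (q + d \<le> fst p \<longrightarrow> val g p = 0)"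
    using r unfolding is_ramp_def by blast
  have out: "val g p = 0" if "p \<notin> split_points B"
  proof -
    have "g \<in> split_C B" using r by (simp add: is_ramp_def jump_free_def)
    with that show ?thesis unfolding split_C_iff by metis
  qed
  show "q \<le> fst p \<and> fst p < q + d" if "val (cut_fun B q) p \<noteq> val g p"
  proof (rule ccontr)
    assume "\<not> ?thesis"
    then consider "p \<notin> split_points B" | "p \<in> split_points B" "fst p < q"
      | "p \<in> split_points B" "q + d \<le> fst p" by linarith
    then show False
      using that e(1) e(2)[of p] out \<open>d > 0\<close> by cases (auto simp: val_cut split: if_splits)
  qed
qed

text \<open>
  If \<open>s q\<close> is the value of \<open>\<Lambda>\<close> at a ramp, then the left hand side is the value of \<open>\<Lambda>\<close> at a
  modification of \<open>f\<close> in which the jump at \<open>q\<close> is smoothed along this ramp; a cut value is up to an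
  arbitrarily small error of this kind.  Each smoothing changes \<open>f\<close> by at most \<open>2 * norm f\<close> on
  a short interval to the right of \<open>q\<close>.  The intervals at points of \<open>I\<close> are disjoint, and
  so are those at the other points, so every point is affected at most twice; hence the constant 5.
\<close>

lemma filled_functional_bound:
  assumes \<Lambda>: "functional_on (jump_free B Q) M \<Lambda>" and "M \<ge> 0"
    and f: "f \<in> split_C B" and J: "finite J" "J \<subseteq> Q" and Q: "Q \<subseteq> B \<inter> {0..1}"
    and nojump: "\<And>q. q \<in> Q - J \<Longrightarrow> jump f q = 0"
    and d: "d > 0" "\<And>q q'. q \<in> I \<Longrightarrow> q' \<in> I \<Longrightarrow> q \<noteq> q' \<Longrightarrow> d \<le> \<bar>q - q'\<bar>"
    and s: "\<And>q. s q = (if q \<in> I then \<Lambda> (ramp B q d) else cut_value B \<Lambda> q)"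
  shows "\<bar>\<Lambda> (fill B J f) - (\<Sum>q\<in>J. jump f q * s q)\<bar> \<le> 5 * M * norm f"
proof (rule field_le_epsilon)
  fix e :: real assume "e > 0"
  have QB: "Q \<subseteq> B" using Q by blast
  define S where "S = (\<Sum>q\<in>J. \<bar>jump f q\<bar>)"
  have "S \<ge> 0" by (simp add: S_def sum_nonneg)
  define \<epsilon> where "\<epsilon> = e / (S + 1)"
  have \<epsilon>: "\<epsilon> > 0" "S * \<epsilon> \<le> e"
    using \<open>S \<ge> 0\<close> \<open>e > 0\<close> by (auto simp: \<epsilon>_def field_simps)
  have "\<exists>\<delta>>0. \<forall>g. is_ramp B Q q \<delta> g \<longrightarrow> \<bar>\<Lambda> g - cut_value B \<Lambda> q\<bar> \<le> \<epsilon>" for q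
    using cut_value_approx[OF \<Lambda> QB \<epsilon>(1)] .
  then obtain D where D: "\<And>q. D q > 0" "\<And>q g. is_ramp B Q q (D q) g \<Longrightarrow> \<bar>\<Lambda> g - cut_value B \<Lambda> q\<bar> \<le> \<epsilon>"
    by metis
  obtain d1 where d1: "d1 > 0" "\<And>q q'. q \<in> J \<Longrightarrow> q' \<in> J \<Longrightarrow> q \<noteq> q' \<Longrightarrow> d1 \<le> \<bar>q - q'\<bar>"
    using finite_separation[OF J(1)] by blast
  obtain \<delta> where \<delta>: "\<delta> > 0" "\<delta> \<le> d1" "\<And>q. q \<in> J \<Longrightarrow> \<delta> \<le> D q"
    using finite_common_width[OF J(1), of D d1] D(1) d1(1) by blast
  \<comment> \<open>The widths d are prescribed on I; the widths \<delta> elsewhere are chosen after J and \<epsilon>.\<close>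
  define w where "w q = (if q \<in> I then d else \<delta>)" for q
  have w: "w q > 0" for q using d(1) \<delta>(1) by (simp add: w_def)
  define g where "g q = ramp B q (w q)" for q
  have ramp: "is_ramp B Q q (w q) (g q)" for q
    unfolding g_def using w QB by (rule is_ramp_ramp)
  have gY: "g q \<in> jump_free B Q" for q using ramp by (simp add: is_ramp_def)
  have err: "\<bar>\<Lambda> (g q) - s q\<bar> \<le> \<epsilon>" if "q \<in> J" for q
  proof (cases "q \<in> I")
    case True
    then show ?thesis using \<epsilon>(1) by (simp add: s g_def w_def)
  next
    case False
    then have "is_ramp B Q q (D q) (g q)"
      using is_ramp_mono[OF ramp[of q]] \<delta>(3)[OF that] by (simp add: w_def)
    then show ?thesis using D(2) False by (simp add: s)
  qed
  have fillY: "fill B J f \<in> jump_free B Q" by (rule fill_in_jump_free[OF f J Q nojump])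
  have sumY: "(\<Sum>q\<in>J. jump f q *\<^sub>R g q) \<in> jump_free B Q"
    using gY subspace_jump_free by (intro subspace_sum subspace_scale) auto
  define h where "h = fill B J f - (\<Sum>q\<in>J. jump f q *\<^sub>R g q)"
  have hY: "h \<in> jump_free B Q"
    unfolding h_def by (rule subspace_diff[OF subspace_jump_free fillY sumY])
  have "norm h \<le> 5 * norm f"
  proof (rule norm_le_valI)
    fix p
    define v where "v q = jump f q * (val (cut_fun B q) p - val (g q) p)" for q
    have vle: "\<bar>v q\<bar> \<le> 2 * norm f" if "q \<in> J" for q
    proof -
      have "q \<in> B" using that J(2) QB by blast
      then have "\<bar>val (cut_fun B q) p - val (g q) p\<bar> \<le> 1" using cut_minus_ramp(1)[OF ramp] w by blast
      then have "\<bar>v q\<bar> \<le> \<bar>jump f q\<bar> * 1" unfolding v_def abs_mult by (intro mult_left_mono) auto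
      then show ?thesis using abs_jump_le[of f q] by linarith
    qed
    have vnz: "q \<le> fst p \<and> fst p < q + w q" if "q \<in> J" "v q \<noteq> 0" for q
    proof -
      have "q \<in> B" using that(1) J(2) QB by blast
      moreover have "val (cut_fun B q) p \<noteq> val (g q) p" using that(2) by (auto simp: v_def)
      ultimately show ?thesis using cut_minus_ramp(2)[OF ramp] w by blast
    qed
    have "\<bar>sum v (J \<inter> I)\<bar> \<le> 2 * norm f"
    proof (rule abs_sum_le_of_disjoint)
      fix q q' assume "q \<in> J \<inter> I" "q' \<in> J \<inter> I" "v q \<noteq> 0" "v q' \<noteq> 0"
      then show "q = q'" using vnz[of q] vnz[of q'] d(2)[of q q'] by (fastforce simp: w_def)
    qed (use J vle in auto)
    moreover have "\<bar>sum v (J - I)\<bar> \<le> 2 * norm f"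
    proof (rule abs_sum_le_of_disjoint)
      fix q q' assume "q \<in> J - I" "q' \<in> J - I" "v q \<noteq> 0" "v q' \<noteq> 0"
      then show "q = q'" using vnz[of q] vnz[of q'] d1(2)[of q q'] \<delta>(2) by (fastforce simp: w_def)
    qed (use J vle in auto)
    moreover have "val h p = val f p + sum v J"
      by (simp add: h_def fill_def v_def right_diff_distrib sum_subtractf)
    moreover have "sum v J = sum v (J \<inter> I) + sum v (J - I)"
      using J(1) by (subst sum.union_disjoint[symmetric]) (auto intro!: arg_cong[of _ _ "sum v"])
    ultimately show "\<bar>val h p\<bar> \<le> 5 * norm f" using abs_val_le_norm[of f p] by linarith
  qed
  then have "M * norm h \<le> M * (5 * norm f)" using assms(2) by (rule mult_left_mono)
  moreover have "\<bar>\<Lambda> h\<bar> \<le> M * norm h" using \<Lambda> hY unfolding functional_on_def by blast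
  moreover have "\<Lambda> h = \<Lambda> (fill B J f) - (\<Sum>q\<in>J. jump f q * \<Lambda> (g q))"
    unfolding h_def functional_on_diff[OF \<Lambda> subspace_jump_free fillY sumY]
    by (simp add: functional_on_lincomb[OF \<Lambda> subspace_jump_free J(1) gY])
  moreover have "\<bar>(\<Sum>q\<in>J. jump f q * \<Lambda> (g q)) - (\<Sum>q\<in>J. jump f q * s q)\<bar> \<le> e"
  proof -
    have "\<bar>\<Sum>q\<in>J. jump f q * (\<Lambda> (g q) - s q)\<bar> \<le> (\<Sum>q\<in>J. \<bar>jump f q\<bar> * \<epsilon>)"
      using err by (intro order_trans[OF sum_abs sum_mono]) (auto simp: abs_mult intro: mult_left_mono)
    also have "\<dots> = S * \<epsilon>" by (simp add: S_def sum_distrib_right)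
    finally show ?thesis using \<epsilon>(2) by (simp add: right_diff_distrib sum_subtractf)
  qed
  ultimately show "\<bar>\<Lambda> (fill B J f) - (\<Sum>q\<in>J. jump f q * s q)\<bar> \<le> 5 * M * norm f + e"
    by linarith
qed

text \<open>
  The diagonal index: \<open>\<kappa> n\<close> is the largest \<open>k \<le> n\<close> for which the condition already holds at \<open>n\<close>.
\<close>

lemma slow_index:
  assumes "\<And>n. R 0 n" and ev: "\<And>k::nat. \<exists>N. \<forall>n\<ge>N. R k n"
  obtains \<kappa> where "\<And>n::nat. R (\<kappa> n) n" "\<And>k. \<exists>N. \<forall>n\<ge>N. k \<le> \<kappa> n"
proof
  define \<kappa> where "\<kappa> n = Max {k. k \<le> n \<and> R k n}" for n
  have fin: "finite {k. k \<le> n \<and> R k n}" for n by simp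
  show "R (\<kappa> n) n" for n
    using Max_in[OF fin, of n] assms(1)[of n] unfolding \<kappa>_def by blast
  show "\<exists>N. \<forall>n\<ge>N. k \<le> \<kappa> n" for k
  proof -
    obtain N where "\<forall>n\<ge>N. R k n" using ev by blast
    then have "\<forall>n\<ge>max N k. k \<le> \<kappa> n" unfolding \<kappa>_def using fin by (auto intro!: Max_ge)
    then show ?thesis by blast
  qed
qed

text \<open>
  The corrected cut values: the first \<open>\<kappa> n\<close> exceptional points get values at ramps of the common
  width \<open>d (\<kappa> n)\<close>, small enough to make these ramps disjoint.  For each fixed \<open>k\<close> the finitely many
  ramps belonging to \<open>k\<close> are fixed functions on which \<open>\<Lambda>\<^sub>n\<close> tends to 0, so \<open>\<kappa>\<close> can grow so slowly
  that the values tend to 0.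
\<close>

lemma null_cut_corrections:
  fixes \<Lambda> :: "nat \<Rightarrow> ((real \<times> real) discrete \<Rightarrow>\<^sub>C real) \<Rightarrow> real"
  assumes \<Lambda>: "\<And>n. functional_on (jump_free B Q) M (\<Lambda> n)" and "M \<ge> 0"
    and null: "\<And>f. f \<in> jump_free B Q \<Longrightarrow> (\<lambda>n. \<Lambda> n f) \<longlonglongrightarrow> 0"
    and Q: "Q \<subseteq> B \<inter> {0..1}"
    and count: "countable {q \<in> Q. \<not> (\<lambda>n. cut_value B (\<Lambda> n) q) \<longlonglongrightarrow> 0}"
  obtains s where "\<And>q. q \<in> Q \<Longrightarrow> (\<lambda>n. s n q) \<longlonglongrightarrow> 0"
    "\<And>n f J. f \<in> split_C B \<Longrightarrow> finite J \<Longrightarrow> J \<subseteq> Q \<Longrightarrow> (\<And>q. q \<in> Q - J \<Longrightarrow> jump f q = 0) \<Longrightarrow>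
       \<bar>\<Lambda> n (fill B J f) - (\<Sum>q\<in>J. jump f q * s n q)\<bar> \<le> 5 * M * norm f"
proof -
  have QB: "Q \<subseteq> B" using Q by blast
  let ?R = "{q \<in> Q. \<not> (\<lambda>n. cut_value B (\<Lambda> n) q) \<longlonglongrightarrow> 0}"
  obtain r :: "nat \<Rightarrow> real" where r: "?R \<subseteq> range r"
    using count by (metis (no_types, lifting) empty_subsetI range_from_nat_into subset_refl)
  have "\<exists>d>0. \<forall>q\<in>r ` {..<k}. \<forall>q'\<in>r ` {..<k}. q \<noteq> q' \<longrightarrow> d \<le> \<bar>q - q'\<bar>" for k
    by (rule finite_separation) simp
  then obtain d where d: "\<And>k::nat. d k > 0"
    "\<And>k q q'. q \<in> r ` {..<k} \<Longrightarrow> q' \<in> r ` {..<k} \<Longrightarrow> q \<noteq> q' \<Longrightarrow> d k \<le> \<bar>q - q'\<bar>" by metis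
  have rampY: "ramp B q (d k) \<in> jump_free B Q" for q k
    using is_ramp_ramp[OF d(1) QB, of q k] by (simp add: is_ramp_def)
  define P where "P k n \<longleftrightarrow> (\<forall>i<k. \<bar>\<Lambda> n (ramp B (r i) (d k))\<bar> < 1 / (real k + 1))" for k n
  have "P 0 n" for n by (simp add: P_def)
  moreover have "\<exists>N. \<forall>n\<ge>N. P k n" for k
  proof -
    have "eventually (\<lambda>n. \<bar>\<Lambda> n (ramp B (r i) (d k))\<bar> < 1 / (real k + 1)) sequentially" for i
      using null[OF rampY[of "r i" k]] by (auto simp: tendsto_iff dist_real_def)
    then have "eventually (\<lambda>n. \<forall>i\<in>{..<k}. \<bar>\<Lambda> n (ramp B (r i) (d k))\<bar> < 1 / (real k + 1)) sequentially"
      by (intro eventually_ball_finite) auto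
    then show ?thesis unfolding P_def eventually_sequentially by auto
  qed
  ultimately obtain \<kappa> where \<kappa>: "\<And>n. P (\<kappa> n) n" "\<And>k. \<exists>N. \<forall>n\<ge>N. k \<le> \<kappa> n"
    using slow_index[of P] by blast
  define s where "s n q = (if q \<in> r ` {..<\<kappa> n} then \<Lambda> n (ramp B q (d (\<kappa> n))) else cut_value B (\<Lambda> n) q)"
    for n q
  show thesis
  proof (rule that[of s])
    fix q assume q: "q \<in> Q"
    show "(\<lambda>n. s n q) \<longlonglongrightarrow> 0"
    proof (cases "q \<in> range r")
      case True
      then obtain i where i: "q = r i" by blast
      show ?thesis
      proof (rule LIMSEQ_I)
        fix e :: real assume "e > 0"
        then obtain k where k: "1 / (real k + 1) < e"
          using reals_Archimedean by (auto simp: inverse_eq_divide add.commute)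
        obtain N where N: "\<And>n. n \<ge> N \<Longrightarrow> max k (Suc i) \<le> \<kappa> n" using \<kappa>(2) by blast
        have "\<bar>s n q\<bar> < e" if "n \<ge> N" for n
        proof -
          have n: "k \<le> \<kappa> n" "i < \<kappa> n" using N[OF that] by auto
          then have "\<bar>s n q\<bar> < 1 / (real (\<kappa> n) + 1)" using \<kappa>(1)[of n] i by (simp add: s_def P_def)
          also have "\<dots> \<le> 1 / (real k + 1)" using n(1) by (intro divide_left_mono) auto
          finally show ?thesis using k by linarith
        qed
        then show "\<exists>N. \<forall>n\<ge>N. norm (s n q - 0) < e" by auto
      qed
    next
      case False
      then have "s n q = cut_value B (\<Lambda> n) q" for n by (auto simp: s_def)
      then show ?thesis using r False q by auto
    qed
  next
    fix n f J assume "f \<in> split_C B" "finite J" "J \<subseteq> Q" "\<And>q. q \<in> Q - J \<Longrightarrow> jump f q = 0"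
    then show "\<bar>\<Lambda> n (fill B J f) - (\<Sum>q\<in>J. jump f q * s n q)\<bar> \<le> 5 * M * norm f"
      using d by (intro filled_functional_bound[OF \<Lambda> assms(2) _ _ _ Q, where I = "r ` {..<\<kappa> n}" and d = "d (\<kappa> n)"])
        (auto simp: s_def)
  qed
qed

lemma bounded_operator_on_functionals:
  fixes T :: "'a::real_normed_vector \<Rightarrow> nat \<Rightarrow>\<^sub>C real"
  assumes "bounded_operator_on Y T"
  obtains M where "M \<ge> 0" "\<And>n. functional_on Y M (\<lambda>f. apply_bcontfun (T f) n)"
proof -
  obtain C where C: "\<And>x. x \<in> Y \<Longrightarrow> norm (T x) \<le> C * norm x"
    using assms unfolding bounded_operator_on_def by blast
  have "functional_on Y \<bar>C\<bar> (\<lambda>f. apply_bcontfun (T f) n)" for n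
    unfolding functional_on_def
  proof (intro conjI ballI allI)
    fix f assume f: "f \<in> Y"
    have "\<bar>apply_bcontfun (T f) n\<bar> \<le> norm (T f)" using norm_bounded[of "T f" n] by simp
    also have "\<dots> \<le> C * norm f" by (rule C[OF f])
    also have "\<dots> \<le> \<bar>C\<bar> * norm f" by (intro mult_right_mono) auto
    finally show "\<bar>apply_bcontfun (T f) n\<bar> \<le> \<bar>C\<bar> * norm f" .
  qed (use assms in \<open>auto simp: bounded_operator_on_def plus_bcontfun.rep_eq scaleR_bcontfun.rep_eq\<close>)
  then show thesis by (rule that[rotated]) simp
qed

lemma c0_of_null_sequence:
  assumes "x \<longlonglongrightarrow> 0"
  obtains \<sigma> :: "nat \<Rightarrow>\<^sub>C real" where "\<sigma> \<in> c0" "\<And>n. apply_bcontfun \<sigma> n = x n"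
proof -
  have "bounded (range x)" using assms by (auto intro: convergent_imp_bounded simp: convergent_def)
  then have "x \<in> bcontfun"
    by (simp add: bcontfun_def continuous_on_open_invariant open_discrete)
  then have "apply_bcontfun (Bcontfun x) = x" by (rule Bcontfun_inverse)
  with assms show thesis by (intro that[of "Bcontfun x"]) (auto simp: c0_def)
qed

lemma subspace_c0: "subspace c0"
  unfolding subspace_def c0_def
  by (auto simp: plus_bcontfun.rep_eq scaleR_bcontfun.rep_eq zero_bcontfun.rep_eq
      intro: tendsto_add_zero tendsto_mult_right_zero)

text \<open>
  On functions with finitely many jumps the extension fills the jumps, applies \<open>T\<close>, and subtracts the
  prescribed images \<open>\<sigma> q\<close> of the cuts that were added; density then gives all of \<open>C(K)\<close>.
\<close>

lemma extend_c0_operator: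
  fixes T :: "(real \<times> real) discrete \<Rightarrow>\<^sub>C real \<Rightarrow> nat \<Rightarrow>\<^sub>C real"
  assumes T: "bounded_operator_on (jump_free B Q) T" "T ` jump_free B Q \<subseteq> c0"
    and Q: "Q \<subseteq> B \<inter> {0..1}"
    and count: "countable {q \<in> Q. \<not> (\<lambda>n. cut_value B (\<lambda>f. apply_bcontfun (T f) n) q) \<longlonglongrightarrow> 0}"
  shows "\<exists>S. bounded_operator_on (split_C B) S \<and> S ` split_C B \<subseteq> c0 \<and> (\<forall>f\<in>jump_free B Q. S f = T f)"
proof -
  obtain M where M: "M \<ge> 0" "\<And>n. functional_on (jump_free B Q) M (\<lambda>f. apply_bcontfun (T f) n)"
    using bounded_operator_on_functionals[OF T(1)] by blast
  have null: "(\<lambda>n. apply_bcontfun (T f) n) \<longlonglongrightarrow> 0" if "f \<in> jump_free B Q" for f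
    using T(2) that by (auto simp: c0_def)
  obtain s where s: "\<And>q. q \<in> Q \<Longrightarrow> (\<lambda>n. s n q) \<longlonglongrightarrow> 0"
    and bound: "\<And>n f J. f \<in> split_C B \<Longrightarrow> finite J \<Longrightarrow> J \<subseteq> Q \<Longrightarrow> (\<And>q. q \<in> Q - J \<Longrightarrow> jump f q = 0) \<Longrightarrow>
       \<bar>apply_bcontfun (T (fill B J f)) n - (\<Sum>q\<in>J. jump f q * s n q)\<bar> \<le> 5 * M * norm f"
    using null_cut_corrections[OF M(2,1) null Q count] by blast
  have "\<exists>\<sigma>. q \<in> Q \<longrightarrow> \<sigma> \<in> c0 \<and> (\<forall>n. apply_bcontfun \<sigma> n = s n q)" for q
    using c0_of_null_sequence[OF s] by metis
  then obtain \<sigma> where \<sigma>: "\<And>q. q \<in> Q \<Longrightarrow> \<sigma> q \<in> c0" "\<And>q n. q \<in> Q \<Longrightarrow> apply_bcontfun (\<sigma> q) n = s n q"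
    by metis
  define X where "X = {f \<in> split_C B. finite {q\<in>Q. jump f q \<noteq> 0}}"
  define S where "S J f = T (fill B J f) - (\<Sum>q\<in>J. jump f q *\<^sub>R \<sigma> q)" for J f
  define supp where "supp f = {q\<in>Q. jump f q \<noteq> 0}" for f
  have supp: "finite (supp f)" "supp f \<subseteq> Q" if "f \<in> X" for f
    using that by (auto simp: X_def supp_def)
  \<comment> \<open>The value does not depend on the finite set of jumps that is filled, which makes S linear.\<close>
  have enlarge: "S J f = S (supp f) f" if "finite J" "supp f \<subseteq> J" "J \<subseteq> Q" for J f
  proof -
    have "(\<Sum>q\<in>J. jump f q *\<^sub>R cut_fun B q) = (\<Sum>q\<in>supp f. jump f q *\<^sub>R cut_fun B q)"
      "(\<Sum>q\<in>J. jump f q *\<^sub>R \<sigma> q) = (\<Sum>q\<in>supp f. jump f q *\<^sub>R \<sigma> q)"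
      using that by (auto intro!: sum.mono_neutral_right simp: supp_def)
    then show ?thesis by (simp add: S_def fill_def)
  qed
  have fillY: "fill B J f \<in> jump_free B Q" if "f \<in> X" "finite J" "supp f \<subseteq> J" "J \<subseteq> Q" for J f
    using that by (intro fill_in_jump_free[OF _ _ _ Q]) (auto simp: X_def supp_def)
  have Tadd: "T (f + g) = T f + T g" if "f \<in> jump_free B Q" "g \<in> jump_free B Q" for f g
    using T(1) that unfolding bounded_operator_on_def by blast
  have Tscale: "T (a *\<^sub>R f) = a *\<^sub>R T f" if "f \<in> jump_free B Q" for a f
    using T(1) that unfolding bounded_operator_on_def by blast
  have X_add: "f + g \<in> X" if "f \<in> X" "g \<in> X" for f g
  proof -
    have "{q \<in> Q. jump (f + g) q \<noteq> 0} \<subseteq> supp f \<union> supp g" by (auto simp: supp_def jump_add)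
    then have "finite {q \<in> Q. jump (f + g) q \<noteq> 0}"
      using supp(1)[OF that(1)] supp(1)[OF that(2)] by (meson finite_UnI finite_subset)
    then show ?thesis using that subspace_add[OF subspace_split_C] by (auto simp: X_def)
  qed
  have X_scale: "a *\<^sub>R f \<in> X" if "f \<in> X" for a f
  proof -
    have "{q \<in> Q. jump (a *\<^sub>R f) q \<noteq> 0} \<subseteq> supp f" by (auto simp: supp_def jump_scaleR)
    then have "finite {q \<in> Q. jump (a *\<^sub>R f) q \<noteq> 0}" using supp(1)[OF that] by (rule finite_subset)
    then show ?thesis using that subspace_scale[OF subspace_split_C] by (auto simp: X_def)
  qed
  have free: "f \<in> X" "supp f = {}" if "f \<in> jump_free B Q" for f
  proof -
    show s0: "supp f = {}" using that by (auto simp: supp_def jump_free_def jump_def)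
    have "finite {q \<in> Q. jump f q \<noteq> 0}" using s0 unfolding supp_def by (metis finite.emptyI)
    with that show "f \<in> X" unfolding X_def jump_free_def by blast
  qed
  have "subspace X"
    unfolding subspace_def using X_add X_scale free(1)[OF subspace_0[OF subspace_jump_free]] by blast
  moreover have "bounded_operator_on X (\<lambda>f. S (supp f) f)"
    unfolding bounded_operator_on_def
  proof (intro conjI ballI allI exI)
    fix f g assume fg: "f \<in> X" "g \<in> X"
    let ?J = "supp f \<union> supp g"
    have J: "finite ?J" "?J \<subseteq> Q" using supp fg by auto
    have sub: "supp (f + g) \<subseteq> ?J" by (auto simp: supp_def jump_add)
    have "fill B ?J (f + g) = fill B ?J f + fill B ?J g"
      by (simp add: fill_def jump_add scaleR_add_left sum.distrib)
    then have "S ?J (f + g) = S ?J f + S ?J g"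
      using fillY[OF fg(1) J(1) _ J(2)] fillY[OF fg(2) J(1) _ J(2)]
      by (simp add: S_def Tadd jump_add scaleR_add_left sum.distrib)
    then show "S (supp (f + g)) (f + g) = S (supp f) f + S (supp g) g"
      using enlarge[OF J(1) _ J(2)] sub by auto
  next
    fix a f assume f: "f \<in> X"
    have sub: "supp (a *\<^sub>R f) \<subseteq> supp f" by (auto simp: supp_def jump_scaleR)
    have "fill B (supp f) (a *\<^sub>R f) = a *\<^sub>R fill B (supp f) f"
      by (simp add: fill_def jump_scaleR scaleR_add_right scaleR_sum_right)
    then have "S (supp f) (a *\<^sub>R f) = a *\<^sub>R S (supp f) f"
      using fillY[OF f supp(1)[OF f] _ supp(2)[OF f]]
      by (simp add: S_def Tscale jump_scaleR scaleR_diff_right scaleR_sum_right)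
    then show "S (supp (a *\<^sub>R f)) (a *\<^sub>R f) = a *\<^sub>R S (supp f) f"
      using enlarge[OF supp(1)[OF f] sub supp(2)[OF f]] by simp
  next
    fix f assume f: "f \<in> X"
    show "norm (S (supp f) f) \<le> 5 * M * norm f"
    proof (rule norm_bound)
      fix n
      have "apply_bcontfun (\<Sum>q\<in>J. jump f q *\<^sub>R \<sigma> q) n = (\<Sum>q\<in>J. jump f q * apply_bcontfun (\<sigma> q) n)" for J
        by (induction J rule: infinite_finite_induct)
          (auto simp: plus_bcontfun.rep_eq scaleR_bcontfun.rep_eq zero_bcontfun.rep_eq)
      also have "(\<Sum>q\<in>supp f. jump f q * apply_bcontfun (\<sigma> q) n) = (\<Sum>q\<in>supp f. jump f q * s n q)"
        using \<sigma>(2) supp(2)[OF f] by (intro sum.cong) auto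
      finally have "apply_bcontfun (S (supp f) f) n
          = apply_bcontfun (T (fill B (supp f) f)) n - (\<Sum>q\<in>supp f. jump f q * s n q)"
        by (simp add: S_def minus_bcontfun.rep_eq)
      moreover have "\<bar>apply_bcontfun (T (fill B (supp f) f)) n - (\<Sum>q\<in>supp f. jump f q * s n q)\<bar>
          \<le> 5 * M * norm f"
      proof (rule bound[OF _ supp[OF f]])
        show "f \<in> split_C B" using f by (simp add: X_def)
        show "jump f q = 0" if "q \<in> Q - supp f" for q using that by (auto simp: supp_def)
      qed
      ultimately show "norm (apply_bcontfun (S (supp f) f) n) \<le> 5 * M * norm f" by simp
    qed
  qed
  moreover have "(\<lambda>f. S (supp f) f) ` X \<subseteq> c0"
  proof
    fix z assume "z \<in> (\<lambda>f. S (supp f) f) ` X"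
    then obtain f where f: "f \<in> X" "z = S (supp f) f" by blast
    have "T (fill B (supp f) f) \<in> c0" using fillY[OF f(1) supp(1)[OF f(1)] _ supp(2)[OF f(1)]] T(2) by blast
    moreover have "(\<Sum>q\<in>supp f. jump f q *\<^sub>R \<sigma> q) \<in> c0"
      using \<sigma>(1) supp(2)[OF f(1)] by (intro subspace_sum subspace_scale subspace_c0) auto
    ultimately show "z \<in> c0" unfolding f(2) S_def by (rule subspace_diff[OF subspace_c0])
  qed
  ultimately obtain S' where S': "bounded_operator_on (closure X) S'" "S' ` closure X \<subseteq> c0"
    "\<And>f. f \<in> X \<Longrightarrow> S' f = S (supp f) f"
    using closed_imp_complete_bcontfun[OF closed_c0] extend_operator_to_closure[of X "\<lambda>f. S (supp f) f" c0] by metis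
  have "X = {f \<in> split_C B. finite {q\<in>Q. val f (q, 1) \<noteq> val f (q, 0)}}"
    by (simp add: X_def jump_def)
  then have dense: "split_C B \<subseteq> closure X" using finitely_many_jumps_dense[of Q B] Q by auto
  then have "bounded_operator_on (split_C B) S'" "S' ` split_C B \<subseteq> c0"
    using S'(1,2) unfolding bounded_operator_on_def by blast+
  moreover have "S' f = T f" if "f \<in> jump_free B Q" for f
    using S'(3) free[OF that] by (simp add: S_def fill_def)
  ultimately show ?thesis by blast
qed



section \<open>A Borel set that countably many of its G-delta subsets do not cover\<close>

text \<open>
  Real numbers serve as codes for sets of naturals.  Ternary expansions with digits 0 and 1 are
  unambiguous, since their tails are at most \<open>1/2\<close> of the current unit; so every set is read off
  from its code by floor operations, which are Borel.
\<close>

definition ternary_sum :: "nat set \<Rightarrow> real" where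
  "ternary_sum E = (\<Sum>i. (if i \<in> E then 1 else 0) * (1/3) ^ i)"

lemma ternary_summable: "summable (\<lambda>i. (if i \<in> E then 1 else 0) * (1/3::real) ^ i)"
  by (rule summable_comparison_test[of _ "\<lambda>i. (1/3::real) ^ i"]) (auto intro: summable_geometric)

lemma ternary_sum_bounds: "0 \<le> ternary_sum E" "ternary_sum E \<le> 3/2"
proof -
  show "0 \<le> ternary_sum E"
    unfolding ternary_sum_def by (intro suminf_nonneg ternary_summable) auto
  have "ternary_sum E \<le> (\<Sum>i. (1/3::real) ^ i)"
    unfolding ternary_sum_def by (intro suminf_le ternary_summable summable_geometric) auto
  also have "\<dots> = 3/2" by (simp add: suminf_geometric)
  finally show "ternary_sum E \<le> 3/2" .
qed

lemma ternary_sum_head: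
  "ternary_sum E = (if 0 \<in> E then 1 else 0) + ternary_sum {i. Suc i \<in> E} / 3"
proof -
  have "(\<Sum>i. (if Suc i \<in> E then 1 else 0) * (1/3::real) ^ Suc i)
      = ternary_sum E - (if 0 \<in> E then 1 else 0)"
    unfolding ternary_sum_def by (subst suminf_split_head[OF ternary_summable]) simp
  moreover have "(\<Sum>i. (if Suc i \<in> E then 1 else 0) * (1/3::real) ^ Suc i)
      = (\<Sum>i. ((if i \<in> {i. Suc i \<in> E} then 1 else 0) * (1/3::real) ^ i) * (1/3))"
    by (intro suminf_cong) auto
  moreover have "\<dots> = ternary_sum {i. Suc i \<in> E} * (1/3)"
    unfolding ternary_sum_def by (rule suminf_mult2[symmetric, OF ternary_summable])
  ultimately show ?thesis by simp
qed

lemma ternary_sum_shift: "\<exists>m::int. 3 ^ j * ternary_sum E = 3 * of_int m + ternary_sum {i. i + j \<in> E}"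
proof (induction j)
  case 0
  show ?case by (intro exI[of _ 0]) simp
next
  case (Suc j)
  then obtain m :: int where m: "3 ^ j * ternary_sum E = 3 * of_int m + ternary_sum {i. i + j \<in> E}" by blast
  define b :: int where "b = (if j \<in> E then 1 else 0)"
  have "ternary_sum {i. i + j \<in> E} = b + ternary_sum {i. i + Suc j \<in> E} / 3"
    by (subst ternary_sum_head) (simp add: b_def)
  with m have "3 ^ Suc j * ternary_sum E = 3 * of_int (3 * m + b) + ternary_sum {i. i + Suc j \<in> E}"
    by (simp add: algebra_simps)
  then show ?case by (rule exI)
qed

text \<open>
  The digit in front of those used is reserved: the codes of the form \<open>1/3 + ternary_sum E / 9\<close> lie in the open
  unit interval even for the empty set.
\<close>

definition ternary_code :: "real \<Rightarrow> nat set" where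
  "ternary_code x = {j. \<lfloor>3 ^ (j + 2) * x\<rfloor> mod 3 = 1}"

lemma ternary_code_measurable: "{x. j \<in> ternary_code x} \<in> sets borel"
proof -
  have "(\<lambda>x::real. \<lfloor>3 ^ (j + 2) * x\<rfloor>) \<in> measurable borel (count_space UNIV)"
    by measurable
  then have "(\<lambda>x::real. \<lfloor>3 ^ (j + 2) * x\<rfloor>) -` {k. k mod 3 = 1} \<inter> space borel \<in> sets borel"
    by (rule measurable_sets) simp
  then show ?thesis by (simp add: ternary_code_def vimage_def)
qed

lemma ternary_code_surj: "\<exists>x\<in>{0<..<1}. ternary_code x = E"
proof (rule bexI)
  let ?x = "1/3 + ternary_sum E / 9"
  show "?x \<in> {0<..<1}" using ternary_sum_bounds[of E] by simp
  show "ternary_code ?x = E"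
  proof (rule set_eqI)
    fix j
    obtain m :: int where m: "3 ^ j * ternary_sum E = 3 * of_int m + ternary_sum {i. i + j \<in> E}"
      using ternary_sum_shift by blast
    define b :: int where "b = (if j \<in> E then 1 else 0)"
    have head: "ternary_sum {i. i + j \<in> E} = b + ternary_sum {i. Suc (i + j) \<in> E} / 3"
      by (subst ternary_sum_head) (simp add: b_def)
    have "3 ^ (j + 2) * ?x = 3 * 3 ^ j + 3 ^ j * ternary_sum E"
      by (simp add: power_add algebra_simps)
    also have "\<dots> = of_int (3 * (3 ^ j + m) + b) + ternary_sum {i. Suc (i + j) \<in> E} / 3"
      unfolding m head by (simp add: algebra_simps)
    finally have "\<lfloor>3 ^ (j + 2) * ?x\<rfloor> = 3 * (3 ^ j + m) + b"
      using ternary_sum_bounds[of "{i. Suc (i + j) \<in> E}"] by (intro floor_unique) auto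
    then have "\<lfloor>3 ^ (j + 2) * ?x\<rfloor> mod 3 = b mod 3" by (simp only: mod_mult_self4)
    then show "j \<in> ternary_code ?x \<longleftrightarrow> j \<in> E" by (simp add: ternary_code_def b_def)
  qed
qed

text \<open>
  Cantor's diagonal argument: if countably many sets coded by the members of \<open>X\<close> covered \<open>P\<close> from
  within, then \<open>P\<close> would be the union of the sets whose codes are the rows of a single
  \<open>E\<close>; but a real \<open>x\<close> with code \<open>E\<close> belongs to \<open>P\<close> if and only if it is not in that union.
\<close>

lemma diagonal_not_covered:
  assumes X: "countable X" and G: "G {} = {}"
    and P: "P = {x \<in> {0<..<1}. x \<notin> (\<Union>k. G {j. prod_encode (k, j) \<in> ternary_code x})}"
    and sub: "\<And>x. x \<in> X \<Longrightarrow> G (ternary_code x) \<subseteq> P"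
  shows "\<not> P \<subseteq> (\<Union>x\<in>X. G (ternary_code x))"
proof
  assume cover: "P \<subseteq> (\<Union>x\<in>X. G (ternary_code x))"
  \<comment> \<open>For empty X the rows are empty, and so are the sets that they code.\<close>
  define R where "R k = (if X = {} then {} else ternary_code (from_nat_into X k))" for k
  define E where "E = {e. snd (prod_decode e) \<in> R (fst (prod_decode e))}"
  have row: "{j. prod_encode (k, j) \<in> E} = R k" for k
    by (simp add: E_def)
  obtain x where x: "x \<in> {0<..<1}" "ternary_code x = E"
    using ternary_code_surj[of E] by (elim bexE)
  have "(\<Union>k. G (R k)) = (\<Union>x\<in>X. G (ternary_code x))"
  proof (cases "X = {}")
    case True
    then show ?thesis by (simp add: R_def G)
  next
    case False
    have "(\<Union>x\<in>range (from_nat_into X). G (ternary_code x)) = (\<Union>k. G (R k))"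
      using False by (simp add: R_def)
    then show ?thesis unfolding range_from_nat_into[OF False X] by simp
  qed
  also have "\<dots> = P" using cover sub by blast
  finally have "(\<Union>k. G (R k)) = P" .
  moreover have "x \<in> P \<longleftrightarrow> x \<notin> (\<Union>k. G (R k))"
    using x(1) by (subst P) (simp add: x(2) row)
  ultimately show False by simp
qed

text \<open>
  A G-delta set is coded by the relation telling which basic open sets lie in its \<open>m\<close>-th open set.
  Thus \<open>H\<close> runs over all G-delta sets as its argument runs over the reals.
\<close>

lemma Borel_set_not_covered:
  obtains P :: "real set" and H :: "real \<Rightarrow> real set" where "P \<in> sets borel" "P \<subseteq> {0<..<1}"
    "\<forall>V. (\<forall>m::nat. open (V m)) \<longrightarrow> (\<exists>x. H x = (\<Inter>m. V m))"
    "\<forall>X. countable X \<longrightarrow> (\<forall>x\<in>X. H x \<subseteq> P) \<longrightarrow> \<not> P \<subseteq> \<Union>(H ` X)"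
proof -
  obtain \<B> :: "real set set" where \<B>: "countable \<B>" "topological_basis \<B>"
    using ex_countable_basis by blast
  have "\<B> \<noteq> {}" using topological_basisE[OF \<B>(2) open_UNIV, of 0] by blast
  define b where "b = from_nat_into \<B>"
  have b: "range b = \<B>" unfolding b_def using \<B> \<open>\<B> \<noteq> {}\<close> by (simp add: range_from_nat_into)
  have b_open: "open (b i)" for i using topological_basis_open[OF \<B>(2)] b by blast
  define G where "G E = (\<Inter>m. \<Union>i\<in>{i. prod_encode (m, i) \<in> E}. b i)" for E
  have G: "\<exists>E. G E = (\<Inter>m. V m)" if V: "\<And>m::nat. open (V m)" for V
  proof -
    have "(\<Union>i\<in>{i. b i \<subseteq> V m}. b i) = V m" for m
    proof (intro equalityI subsetI)
      fix y assume "y \<in> V m"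
      then obtain U where "U \<in> \<B>" "y \<in> U" "U \<subseteq> V m"
        using topological_basisE[OF \<B>(2) V] by metis
      moreover then obtain i where "U = b i" using b by blast
      ultimately show "y \<in> (\<Union>i\<in>{i. b i \<subseteq> V m}. b i)" by blast
    qed auto
    then have "G {prod_encode (m, i) | m i. b i \<subseteq> V m} = (\<Inter>m. V m)" by (simp add: G_def)
    then show ?thesis by blast
  qed
  define H where "H x = G (ternary_code x)" for x
  define P where "P = {x \<in> {0<..<1}. x \<notin> (\<Union>k. G {j. prod_encode (k, j) \<in> ternary_code x})}"
  have "- ({x. prod_encode (k, prod_encode (m, i)) \<in> ternary_code x} \<inter> b i) \<in> sets borel" for k m i
    by (intro borel_comp sets.Int ternary_code_measurable borel_open b_open)
  then have "(\<Inter>i. - ({x. prod_encode (k, prod_encode (m, i)) \<in> ternary_code x} \<inter> b i)) \<in> sets borel" for k m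
    by (intro sets.countable_INT'') auto
  then have "(\<Union>m. \<Inter>i. - ({x. prod_encode (k, prod_encode (m, i)) \<in> ternary_code x} \<inter> b i)) \<in> sets borel" for k
    by (intro sets.countable_UN) auto
  then have "{0<..<1} \<inter> (\<Inter>k. \<Union>m. \<Inter>i.
      - ({x. prod_encode (k, prod_encode (m, i)) \<in> ternary_code x} \<inter> b i)) \<in> sets borel"
    by (intro sets.Int sets.countable_INT'') auto
  also have "{0<..<1} \<inter> (\<Inter>k. \<Union>m. \<Inter>i.
      - ({x. prod_encode (k, prod_encode (m, i)) \<in> ternary_code x} \<inter> b i)) = P"
    unfolding P_def G_def by (rule set_eqI) auto
  finally have Pborel: "P \<in> sets borel" .
  have P01: "P \<subseteq> {0<..<1}" by (auto simp: P_def)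
  have Hcode: "\<exists>x. H x = (\<Inter>m. V m)" if V: "\<And>m::nat. open (V m)" for V
  proof -
    obtain E where E: "G E = (\<Inter>m. V m)" using G[of V, OF V] by (elim exE)
    obtain x where "ternary_code x = E" using ternary_code_surj[of E] by (elim bexE)
    with E show ?thesis unfolding H_def by (intro exI[of _ x]) simp
  qed
  have "G {} = {}" by (simp add: G_def)
  then have notcov: "\<not> P \<subseteq> \<Union>(H ` X)" if "countable X" "\<And>x. x \<in> X \<Longrightarrow> H x \<subseteq> P" for X
    unfolding H_def by (rule diagonal_not_covered[OF that(1) _ P_def]) (use that(2) H_def in auto)
  show thesis
  proof (rule that[OF Pborel P01]; intro allI impI)
    show "\<exists>x. H x = (\<Inter>m. V m)" if "\<forall>m::nat. open (V m)" for V
      using that by (intro Hcode) (rule spec)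
    show "\<not> P \<subseteq> \<Union>(H ` X)" if "countable X" "\<forall>x\<in>X. H x \<subseteq> P" for X
      using that by (intro notcov) (auto dest: bspec)
  qed
qed

section \<open>A Luzin-type subset under the continuum hypothesis\<close>

lemma continuum_hypothesis_order:
  assumes continuum_hypothesis
  obtains r :: "real rel" where "\<And>x y. (x, y) \<in> r \<or> (y, x) \<in> r" "\<And>x. countable {y. (y, x) \<in> r}"
proof -
  let ?r = "|UNIV :: real set|"
  have "Well_order ?r" by (rule card_of_Well_order)
  then have total: "(x, y) \<in> ?r \<or> (y, x) \<in> ?r" for x y
    using wo_rel.TOTALS[of ?r] by (simp add: wo_rel_def Field_card_of)
  have "countable {y. (y, x) \<in> ?r}" for x
  proof -
    have "|underS ?r x| <o ?r"
      by (rule card_of_underS[OF card_of_Card_order]) (simp add: Field_card_of)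
    then have "|underS ?r x| <o cardSuc natLeq"
      using assms ordLess_ordIso_trans unfolding continuum_hypothesis_def by blast
    then have "|underS ?r x| \<le>o natLeq"
      by (rule cardSuc_ordLeq_ordLess[OF natLeq_Card_order card_of_Card_order, THEN iffD1])
    then have "|underS ?r x| \<le>o |UNIV :: nat set|"
      using card_of_nat ordIso_symmetric ordLeq_ordIso_trans by blast
    then obtain f :: "real \<Rightarrow> nat" where "inj_on f (underS ?r x)"
      using card_of_ordLeq[of "underS ?r x" "UNIV :: nat set"] by auto
    then have "countable (underS ?r x)" by (rule countableI)
    moreover have "{y. (y, x) \<in> ?r} \<subseteq> insert x (underS ?r x)" by (auto simp: underS_def)
    ultimately show ?thesis by (meson countable_insert countable_subset)
  qed
  with total show thesis by (rule that)
qed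

text \<open>
  Well-order the codes so that every code has only countably many predecessors, and let \<open>q x\<close> be a
  point of \<open>P\<close> outside all sets \<open>H z \<subseteq> P\<close> with \<open>z\<close> up to \<open>x\<close>.  Then \<open>H z\<close> can only contain
  \<open>q x\<close> for \<open>x\<close> below \<open>z\<close>.  The choice needs no recursion to produce uncountably many
  points: singletons are among the sets \<open>H z\<close>, so each value is taken only countably often.
\<close>

lemma Luzin_type_set:
  fixes H :: "real \<Rightarrow> real set"
  assumes continuum_hypothesis
    and points: "\<And>y. \<exists>x. H x = {y}"
    and not_covered: "\<forall>X. countable X \<longrightarrow> (\<forall>x\<in>X. H x \<subseteq> P) \<longrightarrow> \<not> P \<subseteq> \<Union>(H ` X)"
  obtains Q where "Q \<subseteq> P" "uncountable Q" "\<forall>x. H x \<subseteq> P \<longrightarrow> countable (Q \<inter> H x)"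
proof -
  obtain r :: "real rel" where total: "\<And>x y. (x, y) \<in> r \<or> (y, x) \<in> r"
    and count: "\<And>x. countable {y. (y, x) \<in> r}"
    using continuum_hypothesis_order[OF assms(1)] by blast
  have "\<exists>y. y \<in> P \<and> (\<forall>z. (z, x) \<in> r \<longrightarrow> H z \<subseteq> P \<longrightarrow> y \<notin> H z)" for x
  proof -
    have "countable {z. (z, x) \<in> r \<and> H z \<subseteq> P}"
      by (rule countable_subset[OF _ count[of x]]) auto
    moreover have "\<forall>z\<in>{z. (z, x) \<in> r \<and> H z \<subseteq> P}. H z \<subseteq> P" by blast
    ultimately have "\<not> P \<subseteq> \<Union>(H ` {z. (z, x) \<in> r \<and> H z \<subseteq> P})" using not_covered by metis
    then show ?thesis by auto
  qed
  then obtain q where q: "\<And>x. q x \<in> P" "\<And>x z. (z, x) \<in> r \<Longrightarrow> H z \<subseteq> P \<Longrightarrow> q x \<notin> H z" by metis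
  show thesis
  proof (rule that[of "range q"])
    show "range q \<subseteq> P" using q(1) by blast
    have "countable (range q \<inter> H z)" if "H z \<subseteq> P" for z
    proof (rule countable_subset)
      show "range q \<inter> H z \<subseteq> q ` {x. (x, z) \<in> r}" using total q(2) that by blast
      show "countable (q ` {x. (x, z) \<in> r})" using count by (rule countable_image)
    qed
    then show "\<forall>z. H z \<subseteq> P \<longrightarrow> countable (range q \<inter> H z)" by blast
    show "uncountable (range q)"
    proof
      assume range: "countable (range q)"
      obtain p where p: "\<And>y. H (p y) = {y}" using points by metis
      have "q x \<noteq> y" if "(p y, x) \<in> r" "y \<in> range q" for x y
        using q(2)[OF that(1)] p[of y] that(2) q(1) by auto
      then have "UNIV = (\<Union>y\<in>range q. {x. (x, p y) \<in> r})" using total by blast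
      moreover have "countable (\<Union>y\<in>range q. {x. (x, p y) \<in> r})"
        using range count by (rule countable_UN)
      ultimately show False using uncountable_UNIV_real by simp
    qed
  qed
qed



section \<open>The example\<close>

text \<open>
  A twin has its other twin as an immediate neighbour, so it is not internal, whereas an
  unsplit point inside the unit interval is approached from both sides by other points.
\<close>

lemma internal_point_split_line:
  assumes "P \<subseteq> {0<..<1}"
  shows "{p. internal_point (split_line ({0..1} - P)) p} = (\<lambda>x. (x, 0)) ` P"
proof (intro equalityI subsetI)
  let ?A = "{0..1} - P"
  let ?L = "split_line ?A"
  fix p assume "p \<in> {p. internal_point ?L p}"
  then have p: "p \<in> split_points ?A"
    and up: "\<And>y. y \<in> aboveS ?L p \<Longrightarrow> aboveS ?L p \<inter> underS ?L y \<noteq> {}"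
    and down: "\<And>y. y \<in> underS ?L p \<Longrightarrow> aboveS ?L y \<inter> underS ?L p \<noteq> {}"
    by (auto simp: internal_point_def)
  have "fst p \<notin> ?A"
  proof
    assume A: "fst p \<in> ?A"
    have pts: "(fst p, 0) \<in> split_points ?A" "(fst p, 1) \<in> split_points ?A"
      using A by (auto simp: split_points_def)
    have gap: "aboveS ?L (fst p, 0) \<inter> underS ?L (fst p, 1) = {}"
      by (auto simp: aboveS_def underS_def split_line_def split_points_def prod_eq_iff)
    have adj: "((fst p, 0), (fst p, 1)) \<in> ?L" using pts by (simp add: split_line_def)
    consider "p = (fst p, 0)" | "p = (fst p, 1)" using p by (auto simp: split_points_def prod_eq_iff)
    then show False
    proof cases
      case 1
      have "(fst p, 1) \<in> aboveS ?L (fst p, 0)" using adj by (simp add: aboveS_def)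
      then show False using up[of "(fst p, 1)"] gap 1 by metis
    next
      case 2
      have "(fst p, 0) \<in> underS ?L (fst p, 1)" using adj by (simp add: underS_def)
      then show False using down[of "(fst p, 0)"] gap 2 by metis
    qed
  qed
  then show "p \<in> (\<lambda>x. (x, 0)) ` P"
    using p by (intro image_eqI[of _ _ "fst p"]) (auto simp: split_points_def prod_eq_iff)
next
  let ?A = "{0..1} - P"
  let ?L = "split_line ?A"
  fix p :: "real \<times> real" assume "p \<in> (\<lambda>x. (x, 0)) ` P"
  then obtain x where x: "x \<in> P" "p = (x, 0)" by blast
  then have x01: "0 < x" "x < 1" using assms by auto
  have base: "(y, 0) \<in> split_points ?A" if "0 \<le> y" "y \<le> 1" for y using that by (simp add: split_points_def)
  have "\<not> (\<forall>y\<in>Field ?L. (p, y) \<in> ?L)" "\<not> (\<forall>y\<in>Field ?L. (y, p) \<in> ?L)"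
  proof -
    have "(p, (0, 0)) \<notin> ?L" "((1, 0), p) \<notin> ?L" using x x01 by (auto simp: split_line_def)
    then show "\<not> (\<forall>y\<in>Field ?L. (p, y) \<in> ?L)" "\<not> (\<forall>y\<in>Field ?L. (y, p) \<in> ?L)"
      using base[of 0] base[of 1] by auto
  qed
  moreover have "aboveS ?L p \<inter> underS ?L y \<noteq> {}" if y: "y \<in> aboveS ?L p" for y
  proof -
    have y': "y \<in> split_points ?A" "x < fst y"
      using y x by (auto simp: aboveS_def split_line_def split_points_def prod_eq_iff)
    define z where "z = (x + fst y) / 2"
    have z: "x < z" "z < fst y" "fst y \<le> 1"
      using y' by (auto simp: z_def split_points_def)
    then have "(z, 0) \<in> aboveS ?L p \<inter> underS ?L y"
      using x x01 y' base[of x] base[of z] by (auto simp: aboveS_def underS_def split_line_def)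
    then show ?thesis by blast
  qed
  moreover have "aboveS ?L y \<inter> underS ?L p \<noteq> {}" if y: "y \<in> underS ?L p" for y
  proof -
    have y': "y \<in> split_points ?A" "fst y < x"
      using y x by (auto simp: underS_def split_line_def split_points_def prod_eq_iff)
    define z where "z = (x + fst y) / 2"
    have z: "fst y < z" "z < x" "0 \<le> fst y"
      using y' by (auto simp: z_def split_points_def)
    then have "(z, 0) \<in> aboveS ?L y \<inter> underS ?L p"
      using x x01 y' base[of x] base[of z] by (auto simp: aboveS_def underS_def split_line_def)
    then show ?thesis by blast
  qed
  ultimately show "p \<in> {p. internal_point ?L p}"
    using x base[of x] x01 by (simp add: internal_point_def)
qed

text \<open>
  The real coordinate is a continuous function on a split line.
\<close>

lemma Borel_preimage_fst:
  assumes "S \<in> sets borel"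
  shows "{p \<in> split_points B. fst p \<in> S} \<in> borel_sets_of (order_top (split_line B))"
proof -
  let ?T = "order_top (split_line B)"
  let ?M = "sigma (split_points B) {U. openin ?T U}"
  have opens: "{U. openin ?T U} \<subseteq> Pow (split_points B)"
    using openin_subset by fastforce
  have "fst \<in> borel_measurable ?M"
  proof (rule borel_measurableI)
    fix U :: "real set" assume "open U"
    have "openin ?T {p \<in> split_points B. fst p \<in> U}"
      unfolding openin_split_line
    proof (intro conjI ballI)
      fix p assume p: "p \<in> {p \<in> split_points B. fst p \<in> U}"
      then obtain e where e: "e > 0" "\<And>y. \<bar>y - fst p\<bar> < e \<Longrightarrow> y \<in> U"
        using \<open>open U\<close> by (auto simp: open_dist dist_real_def)
      have "fst q \<in> U" if "q \<in> split_nbhd B p e" for q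
        using that e(1) by (intro e(2)) (auto simp: split_nbhd_def)
      then show "\<exists>\<delta>>0. split_nbhd B p \<delta> \<subseteq> {p \<in> split_points B. fst p \<in> U}"
        using e(1) split_nbhd_subset[of B p e] by (intro exI[of _ e]) auto
    qed auto
    moreover have "fst -` U \<inter> space ?M = {p \<in> split_points B. fst p \<in> U}"
      using opens by (auto simp: space_measure_of_conv)
    ultimately show "fst -` U \<inter> space ?M \<in> sets ?M"
      using opens by (simp add: sigma_sets.Basic)
  qed
  from measurable_sets[OF this assms] have "fst -` S \<inter> split_points B \<in> sets ?M"
    by (simp add: space_measure_of_conv)
  moreover have "fst -` S \<inter> split_points B = {p \<in> split_points B. fst p \<in> S}" by auto
  ultimately show ?thesis using opens by (simp add: borel_sets_of_def)
qed

text \<open>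
  A sufficient criterion for the extension property in terms of \<open>Q\<close> only: the G-delta
  sets provided by \<open>exceptional_cuts\<close> avoid \<open>A\<close>, so by hypothesis they contribute countably many
  exceptional points.
\<close>

lemma c0_extension_property_collapse:
  assumes disj: "A \<inter> Q = {}" and Q: "Q \<subseteq> {0..1}"
    and count: "\<And>V. (\<And>m::nat. open (V m)) \<Longrightarrow> (\<Inter>m. V m) \<inter> A = {} \<Longrightarrow> countable (Q \<inter> (\<Inter>m. V m))"
  shows "has_c0_extension_property (split_line (A \<union> Q)) (split_line A) (collapse Q)"
proof -
  let ?B = "A \<union> Q"
  let ?Y = "jump_free ?B Q"
  have "\<exists>S. bounded_operator_on (split_C ?B) S \<and> S ` split_C ?B \<subseteq> c0 \<and> (\<forall>f\<in>?Y. S f = T f)"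
    if T: "bounded_operator_on ?Y T" "T ` ?Y \<subseteq> c0"
    for T :: "(real \<times> real) discrete \<Rightarrow>\<^sub>C real \<Rightarrow> nat \<Rightarrow>\<^sub>C real"
  proof (rule extend_c0_operator[OF T])
    let ?\<Lambda> = "\<lambda>n f. apply_bcontfun (T f) n"
    obtain M where M: "\<And>n. functional_on ?Y M (?\<Lambda> n)"
      using bounded_operator_on_functionals[OF T(1)] by blast
    have null: "(\<lambda>n. ?\<Lambda> n f) \<longlonglongrightarrow> 0" if "f \<in> ?Y" for f
      using T(2) that by (auto simp: c0_def)
    obtain V :: "nat \<Rightarrow> nat \<Rightarrow> real set" and C where V: "\<And>k m. open (V k m)"
      "\<And>k. (\<Inter>m. V k m) \<inter> (?B - Q) = {}" and C: "countable C"
      "{t. \<not> (\<lambda>n. cut_value ?B (?\<Lambda> n) t) \<longlonglongrightarrow> 0} \<subseteq> (\<Union>k. \<Inter>m. V k m) \<union> C"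
      using exceptional_cuts[OF M null] by blast
    have "?B - Q = A" using disj by blast
    then have "countable (Q \<inter> (\<Inter>m. V k m))" for k
      using V(2)[of k] by (intro count V(1)) simp
    then have "countable ((\<Union>k. Q \<inter> (\<Inter>m. V k m)) \<union> C)"
      by (intro countable_Un countable_UN countableI_type C(1))
    moreover have "{q \<in> Q. \<not> (\<lambda>n. cut_value ?B (?\<Lambda> n) q) \<longlonglongrightarrow> 0} \<subseteq> (\<Union>k. Q \<inter> (\<Inter>m. V k m)) \<union> C"
      using C(2) by blast
    ultimately show "countable {q \<in> Q. \<not> (\<lambda>n. cut_value ?B (?\<Lambda> n) q) \<longlonglongrightarrow> 0}"
      by (rule countable_subset[rotated])
    show "Q \<subseteq> ?B \<inter> {0..1}" using Q by blast
  qed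
  moreover have "complete (split_C ?B)" by (rule closed_imp_complete_bcontfun[OF closed_split_C])
  moreover have "?Y \<subseteq> split_C ?B" by (auto simp: jump_free_def)
  ultimately have "c0_extension_property_in ?Y (split_C ?B)"
    unfolding c0_extension_property_in_def
    using subspace_split_C subspace_jump_free closed_jump_free by blast
  then show ?thesis
    unfolding has_c0_extension_property_def range_pullback_collapse[OF disj] split_C_def .
qed

theorem proposition3p7:
  assumes "continuum_hypothesis"
  shows "\<exists>(K :: (real \<times> real) rel) (L :: (real \<times> real) rel) (\<phi> :: real \<times> real \<Rightarrow> real \<times> real).
    compact_line K \<and> separable_space (order_top K) \<and>
    compact_line L \<and> separable_space (order_top L) \<and> Borel_regular L \<and>
    continuous_increasing_surjection K L \<phi> \<and>
    has_c0_extension_property K L \<phi> \<and>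
    \<not> countable_type K L \<phi>"
proof -
  obtain P :: "real set" and H :: "real \<Rightarrow> real set" where P: "P \<in> sets borel" "P \<subseteq> {0<..<1}"
    and codes: "\<forall>V. (\<forall>m::nat. open (V m)) \<longrightarrow> (\<exists>x. H x = (\<Inter>m. V m))"
    and not_covered: "\<forall>X. countable X \<longrightarrow> (\<forall>x\<in>X. H x \<subseteq> P) \<longrightarrow> \<not> P \<subseteq> \<Union>(H ` X)"
    by (rule Borel_set_not_covered)
  have H: "\<exists>x. H x = (\<Inter>m. V m)" if "\<And>m::nat. open (V m)" for V
    using codes that by simp
  \<comment> \<open>Singletons are G-delta sets, and thus have codes.\<close>
  have points: "\<exists>x. H x = {y}" for y
  proof -
    have "(\<Inter>m::nat. ball y (1 / (real m + 1))) = {y}"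
    proof (intro equalityI subsetI)
      fix z assume z: "z \<in> (\<Inter>m::nat. ball y (1 / (real m + 1)))"
      show "z \<in> {y}"
      proof (rule ccontr)
        assume "z \<notin> {y}"
        then obtain m :: nat where "1 / (real m + 1) < dist y z"
          using reals_Archimedean[of "dist y z"] by (auto simp: inverse_eq_divide add.commute)
        moreover have "dist y z < 1 / (real m + 1)" using z by auto
        ultimately show False by linarith
      qed
    qed auto
    with H[of "\<lambda>m. ball y (1 / (real m + 1))"] show ?thesis by auto
  qed
  obtain Q where Q: "Q \<subseteq> P" "uncountable Q" "\<forall>x. H x \<subseteq> P \<longrightarrow> countable (Q \<inter> H x)"
    by (rule Luzin_type_set[OF assms points not_covered])
  define A where "A = {0..1} - P"
  have disj: "A \<inter> Q = {}" and Q01: "Q \<subseteq> {0..1}" using Q(1) P(2) by (auto simp: A_def)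
  have count: "countable (Q \<inter> (\<Inter>m. V m))"
    if V: "\<And>m::nat. open (V m)" "(\<Inter>m. V m) \<inter> A = {}" for V :: "nat \<Rightarrow> real set"
  proof -
    \<comment> \<open>A G-delta set that avoids A lies in P once it is restricted to the open unit interval.\<close>
    have "\<exists>x. H x = (\<Inter>m. V m \<inter> {0<..<1})"
      using V(1) by (intro H open_Int) auto
    then obtain x where x: "H x = (\<Inter>m. V m \<inter> {0<..<1})" ..
    then have "H x \<subseteq> P" using V(2) by (auto simp: A_def)
    then have "countable (Q \<inter> H x)" using Q(3) by blast
    moreover have "Q \<inter> (\<Inter>m. V m) \<subseteq> Q \<inter> H x" using Q(1) P(2) x by auto
    ultimately show ?thesis by (rule countable_subset[rotated])
  qed
  let ?K = "split_line (A \<union> Q)" and ?L = "split_line A"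
  have internal: "{p. internal_point ?L p} = (\<lambda>x. (x, 0)) ` P"
    unfolding A_def by (rule internal_point_split_line[OF P(2)])
  have "(\<lambda>x. (x, 0)) ` P = {p \<in> split_points A. fst p \<in> P}"
    using P(2) by (auto simp: split_points_def A_def image_iff prod_eq_iff)
  then have "Borel_regular ?L"
    using Borel_preimage_fst[OF P(1), of A]
    by (simp add: Borel_regular_def internal compact_line_split_line separable_split_line)
  moreover have "\<not> countable_type ?K ?L (collapse Q)"
  proof
    assume "countable_type ?K ?L (collapse Q)"
    moreover have "(\<lambda>q. (q, 0)) ` Q \<subseteq> Q0_set ?K ?L (collapse Q)"
    proof
      fix p :: "real \<times> real" assume "p \<in> (\<lambda>q. (q, 0)) ` Q"
      then obtain q where q: "q \<in> Q" "p = (q, 0)" by blast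
      have "(q, 0) \<in> split_points (A \<union> Q)" "(q, 1) \<in> split_points (A \<union> Q)" "(q, 0) \<in> split_points A"
        using q Q01 by (auto simp: split_points_def)
      moreover have "collapse Q (q, 0) = (q, 0)" "collapse Q (q, 1) = (q, 0)"
        using q(1) by (auto simp: collapse_def)
      ultimately have "p \<in> Q_set ?K ?L (collapse Q)"
        unfolding Q_set_def Field_split_line q(2)
        by (intro CollectI conjI bexI[of _ "(q, 0)"] bexI[of _ "(q, 1)"]) auto
      moreover have "internal_point ?L p" using internal q Q(1) by blast
      ultimately show "p \<in> Q0_set ?K ?L (collapse Q)" by (simp add: Q0_set_def)
    qed
    ultimately have "countable ((\<lambda>q. (q, 0::real)) ` Q)"
      unfolding countable_type_def by (rule countable_subset[rotated])
    then have "countable Q" by (rule countable_image_inj_on) (simp add: inj_on_def)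
    with Q(2) show False ..
  qed
  ultimately show ?thesis
    using continuous_increasing_surjection_collapse[OF disj]
      c0_extension_property_collapse[OF disj Q01 count]
      compact_line_split_line separable_split_line
    by (intro exI[of _ ?K] exI[of _ ?L] exI[of _ "collapse Q"]) simp
qed

end
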